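(* If $G$ is an almost bipartite non-König-Egerváry graph with the unique odd cycle $C$, then $$\varrho_v(G)=|V(C)|+|\mathrm{nucleus}(G)|-|\mathrm{core}(G)|.$$
   Context: All graphs are finite, undirected, loopless, without multiple edges; $n(G)=|V(G)|$. $\alpha(G)$ is the maximum size of an independent set and $\mu(G)$ the maximum size of a matching. $G$ is a König-Egerváry graph if $\alpha(G)+\mu(G)=n(G)$. $G$ is almost bipartite if it has exactly one odd cycle. $\varrho_v(G)$ is the number of vertices $v\in V(G)$ such that $G-v$ is a König-Egerváry graph. $\mathrm{core}(G)$ is the intersection of all maximum independent sets of $G$. For $X\subseteq V(G)$, $N_G(X)=\{v: v \text{ has a neighbor in } X\}$ and $d(X)=|X|-|N_G(X)|$; the critical difference is $d(G)=\max\{d(I): I \text{ independent in } G\}$; an independent set $A$ (possibly empty) is a critical independent set if $d(A)=d(G)$. A maximum critical independent set is a critical independent set of largest cardinality among all critical independent sets. $\mathrm{nucleus}(G)$ is the intersection of all maximum critical independent sets of $G$. *)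

theory Defs
  imports Main
begin

record 'a ugraph =
  verts :: "'a set"
  edges :: "'a set set"

definition simple_graph :: "'a ugraph \<Rightarrow> bool" where
  "simple_graph G \<longleftrightarrow> finite (verts G) \<and> edges G \<subseteq> {e. e \<subseteq> verts G \<and> card e = 2}"

definition subgraph :: "'a ugraph \<Rightarrow> 'a ugraph \<Rightarrow> bool" where
  "subgraph H G \<longleftrightarrow> verts H \<subseteq> verts G \<and> edges H \<subseteq> edges G"

definition del_vertex :: "'a ugraph \<Rightarrow> 'a \<Rightarrow> 'a ugraph" where
  "del_vertex G v = \<lparr>verts = verts G - {v}, edges = {e \<in> edges G. v \<notin> e}\<rparr>"

definition independent :: "'a ugraph \<Rightarrow> 'a set \<Rightarrow> bool" where
  "independent G S \<longleftrightarrow> S \<subseteq> verts G \<and> (\<forall>u\<in>S. \<forall>v\<in>S. {u, v} \<notin> edges G)"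

definition independence_number :: "'a ugraph \<Rightarrow> nat" where
  "independence_number G = Max (card ` {S. independent G S})"

definition maximum_independent :: "'a ugraph \<Rightarrow> 'a set \<Rightarrow> bool" where
  "maximum_independent G S \<longleftrightarrow> independent G S \<and> card S = independence_number G"

definition core :: "'a ugraph \<Rightarrow> 'a set" where
  "core G = \<Inter>{S. maximum_independent G S}"

definition matching :: "'a ugraph \<Rightarrow> 'a set set \<Rightarrow> bool" where
  "matching G M \<longleftrightarrow> M \<subseteq> edges G \<and> pairwise disjnt M"

definition matching_number :: "'a ugraph \<Rightarrow> nat" where
  "matching_number G = Max (card ` {M. matching G M})"

definition konig_egervary :: "'a ugraph \<Rightarrow> bool" where
  "konig_egervary G \<longleftrightarrow> independence_number G + matching_number G = card (verts G)"

definition varrho_v :: "'a ugraph \<Rightarrow> nat" where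
  "varrho_v G = card {v \<in> verts G. konig_egervary (del_vertex G v)}"

definition neighborhood :: "'a ugraph \<Rightarrow> 'a set \<Rightarrow> 'a set" where
  "neighborhood G X = {v \<in> verts G. \<exists>x\<in>X. {v, x} \<in> edges G}"

definition set_difference :: "'a ugraph \<Rightarrow> 'a set \<Rightarrow> int" where
  "set_difference G X = int (card X) - int (card (neighborhood G X))"

definition critical_difference :: "'a ugraph \<Rightarrow> int" where
  "critical_difference G = Max (set_difference G ` {I. independent G I})"

definition critical_independent :: "'a ugraph \<Rightarrow> 'a set \<Rightarrow> bool" where
  "critical_independent G A \<longleftrightarrow>
     independent G A \<and> set_difference G A = critical_difference G"

definition maximum_critical_independent :: "'a ugraph \<Rightarrow> 'a set \<Rightarrow> bool" where
  "maximum_critical_independent G A \<longleftrightarrow>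
     critical_independent G A \<and> (\<forall>B. critical_independent G B \<longrightarrow> card B \<le> card A)"

definition nucleus :: "'a ugraph \<Rightarrow> 'a set" where
  "nucleus G = \<Inter>{A. maximum_critical_independent G A}"

text \<open>A cycle is a subgraph, not a vertex sequence: all rotations and reversals of a
  sequence describe the same cycle, whereas different cycles may share their vertex set.\<close>

definition cycle_graph :: "'a list \<Rightarrow> 'a ugraph" where
  "cycle_graph xs = \<lparr>verts = set xs,
     edges = {{xs ! i, xs ! (Suc i mod length xs)} | i. i < length xs}\<rparr>"

definition cycle_of :: "'a ugraph \<Rightarrow> 'a ugraph \<Rightarrow> bool" where
  "cycle_of G C \<longleftrightarrow>
     subgraph C G \<and> (\<exists>xs. distinct xs \<and> length xs \<ge> 3 \<and> C = cycle_graph xs)"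

definition odd_cycle_of :: "'a ugraph \<Rightarrow> 'a ugraph \<Rightarrow> bool" where
  "odd_cycle_of G C \<longleftrightarrow> cycle_of G C \<and> odd (card (edges C))"

definition almost_bipartite :: "'a ugraph \<Rightarrow> bool" where
  "almost_bipartite G \<longleftrightarrow> (\<exists>!C. odd_cycle_of G C)"

end

theory Submission
  imports Defs
begin

text \<open>
  Fix a maximum critical independent set \<open>X\<close>, put \<open>Y = N(X)\<close>, and let \<open>2 k + 1\<close> be the length
  of the odd cycle \<open>C\<close>. The whole argument rests on the fact that \<open>X\<close>, \<open>Y\<close> and \<open>V(C)\<close> partition the
  vertex set (\<open>H_eq_cycle\<close>). Maximality of \<open>X\<close> forces every nonempty independent set outside
  \<open>X \<union> Y\<close> to have strictly more neighbours outside \<open>X \<union> Y\<close> than elements. Since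
  \<open>C\<close> is the only odd cycle, everything except \<open>C\<close> itself breaks up into bipartite pieces, each
  attached to at most one vertex of \<open>C\<close>. Such a piece cannot satisfy the expansion property, as the
  neighbours of a colour class lie in the other class, up to the vertex of attachment. If \<open>C\<close> itself
  met \<open>X \<union> Y\<close>, nothing at all would be left outside \<open>X \<union> Y\<close>, and the graph would be Konig-Egervary,
  because \<open>Y\<close> can be matched into \<open>X\<close> by Hall's theorem.

  From the partition, \<open>\<alpha> = |X| + k\<close> and \<open>\<mu> = |Y| + k\<close>, one less in total than the number of vertices.
  Hence \<open>G - v\<close> is Konig-Egervary exactly when some maximum independent set and some maximum matching
  both miss \<open>v\<close>. This is always so for \<open>v\<close> on \<open>C\<close>, and never for \<open>v\<close> in \<open>Y\<close>, whose vertices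
  are covered by all maximum matchings. As \<open>X\<close> was arbitrary, a vertex outside \<open>C\<close> that counts lies in every
  maximum critical independent set, so in the nucleus, and not in the core.

  Conversely, let \<open>v\<close> be in the nucleus but not in the core, and suppose that no maximum matching
  misses it. Hall's theorem, applied to matching \<open>Y\<close> into \<open>X - {v}\<close> with the whole cycle as one extra
  partner, yields a tight subset of \<open>Y\<close>, that is, one with as many neighbours in \<open>X\<close> as elements, which
  is not adjacent to \<open>C\<close> and has \<open>v\<close> among its neighbours. A maximum independent set missing \<open>v\<close> yields another tight set with neighbour \<open>v\<close>, this
  one independent. Their intersection \<open>R\<close> has all these properties, so exchanging \<open>N(R) \<inter> X\<close> for \<open>R\<close>
  turns \<open>X\<close> into a maximum critical independent set without \<open>v\<close> (\<open>exchange_tight_set\<close>), a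
  contradiction. Thus the vertices that count are those of \<open>C\<close> and those of nucleus minus core, and
  the formula follows since the core is contained in the nucleus, which is disjoint from \<open>C\<close>.
\<close>

section \<open>Distinct representatives\<close>

text \<open>Hall's marriage theorem, by Rado's argument: as long as some \<open>A i\<close> has two elements, one of them can
be deleted without destroying Hall's condition. Otherwise both deletions create a violating
subfamily, and submodularity of the size of a union applied to the two violators contradicts the
condition for \<open>A\<close> itself.\<close>

lemma hall_distinct_representatives:
  fixes A :: "'i \<Rightarrow> 'b set"
  assumes "finite I"
    and "\<And>i. i \<in> I \<Longrightarrow> finite (A i)"
    and "\<And>J. J \<subseteq> I \<Longrightarrow> card J \<le> card (\<Union>(A ` J))"
  shows "\<exists>f. inj_on f I \<and> (\<forall>i\<in>I. f i \<in> A i)"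
  using assms(2,3)
proof (induction "\<Sum>i\<in>I. card (A i)" arbitrary: A rule: less_induct)
  case less
  note fin = less.prems(1) and hall = less.prems(2)
  show ?case
  proof (cases "\<forall>i\<in>I. card (A i) \<le> 1")
    case True
    have "\<exists>a. A i = {a}" if "i \<in> I" for i
    proof -
      have "1 \<le> card (A i)" using hall[of "{i}"] that by simp
      then have "card (A i) = 1" using True that by (simp add: le_antisym)
      then show ?thesis by (auto simp: card_1_singleton_iff)
    qed
    then obtain f where f: "A i = {f i}" if "i \<in> I" for i by metis
    have "inj_on f I"
    proof (rule inj_onI, rule ccontr)
      fix i j assume ij: "i \<in> I" "j \<in> I" "f i = f j" "i \<noteq> j"
      then show False using hall[of "{i, j}"] f by simp
    qed
    with f show ?thesis by auto
  next
    case False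
    then obtain i0 where i0: "i0 \<in> I" "2 \<le> card (A i0)" by force
    then obtain x y where xy: "x \<in> A i0" "y \<in> A i0" "x \<noteq> y"
      by (metis card_2_iff' card_le_Suc0_iff_eq fin not_less_eq_eq numeral_2_eq_2)
    define B where "B z = A(i0 := A i0 - {z})" for z
    have B_UN: "\<Union>(B z ` J) = \<Union>(A ` (J - {i0})) \<union> (A i0 - {z})" if "i0 \<in> J" for z J
      using that by (auto simp: B_def split: if_splits)
    have done_if: ?thesis if z: "z \<in> A i0"
      and hallB: "\<And>J. J \<subseteq> I \<Longrightarrow> card J \<le> card (\<Union>(B z ` J))" for z
    proof -
      have "card (A i0 - {z}) < card (A i0)"
        using z fin i0 by (meson card_Diff1_less)
      then have "(\<Sum>i\<in>I. card (B z i)) < (\<Sum>i\<in>I. card (A i))"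
        using i0 fin by (intro sum_strict_mono_ex1[OF \<open>finite I\<close>]) (auto simp: B_def card_Diff_subset intro: card_mono)
      moreover have "finite (B z i)" if "i \<in> I" for i using fin that i0(1) by (simp add: B_def)
      ultimately obtain f where "inj_on f I" "\<forall>i\<in>I. f i \<in> B z i"
        using less.hyps[of "B z"] hallB by blast
      then show ?thesis by (intro exI[of _ f]) (auto simp: B_def split: if_splits)
    qed
    have violator: "\<exists>J. J \<subseteq> I \<and> i0 \<notin> J \<and> card (\<Union>(A ` J) \<union> (A i0 - {z})) \<le> card J"
      if neg: "\<not> ?thesis" and z: "z \<in> A i0" for z
    proof -
      obtain J where J: "J \<subseteq> I" "card (\<Union>(B z ` J)) < card J"
        using done_if[OF z] neg not_le by blast
      have "i0 \<in> J"
      proof (rule ccontr)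
        assume "i0 \<notin> J"
        then have "B z ` J = A ` J" by (auto simp: B_def)
        then show False using hall[OF J(1)] J(2) by simp
      qed
      moreover have "finite J" using J(1) \<open>finite I\<close> finite_subset by blast
      ultimately show ?thesis using J B_UN
        by (intro exI[of _ "J - {i0}"]) auto
    qed
    show ?thesis
    proof (rule ccontr)
      assume neg: "\<not> ?thesis"
      obtain J K where J: "J \<subseteq> I" "i0 \<notin> J" "card (\<Union>(A ` J) \<union> (A i0 - {x})) \<le> card J"
        and K: "K \<subseteq> I" "i0 \<notin> K" "card (\<Union>(A ` K) \<union> (A i0 - {y})) \<le> card K"
        using violator[OF neg] xy by meson
      let ?P = "\<Union>(A ` J) \<union> (A i0 - {x})" and ?Q = "\<Union>(A ` K) \<union> (A i0 - {y})"
      have finJK: "finite J" "finite K" using J K \<open>finite I\<close> finite_subset by blast+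
      have finPQ: "finite ?P" "finite ?Q" using J K fin i0 finJK by auto
      have "?P \<union> ?Q = \<Union>(A ` insert i0 (J \<union> K))" using xy by auto
      then have "card (insert i0 (J \<union> K)) \<le> card (?P \<union> ?Q)"
        using hall[of "insert i0 (J \<union> K)"] i0 J K by simp
      moreover have "card (J \<inter> K) \<le> card (\<Union>(A ` (J \<inter> K)))" using hall J by blast
      moreover have "\<dots> \<le> card (?P \<inter> ?Q)" using finPQ by (intro card_mono) auto
      moreover have "card (?P \<union> ?Q) + card (?P \<inter> ?Q) = card ?P + card ?Q"
        using card_Un_Int[OF finPQ] by simp
      moreover have "card (J \<union> K) + card (J \<inter> K) = card J + card K"
        using card_Un_Int[OF finJK] by simp
      moreover have "card (insert i0 (J \<union> K)) = Suc (card (J \<union> K))"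
        using J K finJK by simp
      ultimately show False using J(3) K(3) by linarith
    qed
  qed
qed

section \<open>Odd cycles and two-colourings\<close>

definition proper_two_colouring :: "'a set set \<Rightarrow> ('a \<Rightarrow> bool) \<Rightarrow> bool" where
  "proper_two_colouring E f \<longleftrightarrow> (\<forall>a b. {a, b} \<in> E \<longrightarrow> f a \<noteq> f b)"

text \<open>Extending a path by one more vertex either keeps it distinct or closes a loop, which is cut off.\<close>

lemma rtrancl_distinct_path:
  assumes "(u, v) \<in> R\<^sup>*"
  shows "\<exists>xs. xs \<noteq> [] \<and> hd xs = u \<and> last xs = v \<and> distinct xs \<and> successively (\<lambda>a b. (a, b) \<in> R) xs"
  using assms
proof (induction rule: rtrancl_induct)
  case base
  show ?case by (intro exI[of _ "[u]"]) simp
next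
  case (step y z)
  then obtain xs where xs: "xs \<noteq> []" "hd xs = u" "last xs = y" "distinct xs"
    "successively (\<lambda>a b. (a, b) \<in> R) xs" by blast
  show ?case
  proof (cases "z \<in> set xs")
    case False
    with xs step.hyps show ?thesis
      by (intro exI[of _ "xs @ [z]"]) (auto simp: successively_append_iff)
  next
    case True
    then obtain ys zs where "xs = ys @ z # zs" by (meson split_list)
    with xs show ?thesis
      by (intro exI[of _ "ys @ [z]"]) (auto simp: successively_append_iff hd_append)
  qed
qed

lemma alternating_list_parity:
  assumes "successively (\<lambda>a b. f a \<noteq> f b) xs" "xs \<noteq> []"
  shows "(f (hd xs) \<longleftrightarrow> f (last xs)) \<longleftrightarrow> odd (length xs)"
  using assms by (induction xs rule: induct_list012) auto

lemma edges_cycle_graph: 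
  "edges (cycle_graph xs) = (\<lambda>i. {xs ! i, xs ! (Suc i mod length xs)}) ` {..<length xs}"
  by (auto simp: cycle_graph_def)

lemma edges_cycle_graph_subset_iff:
  assumes "xs \<noteq> []"
  shows "edges (cycle_graph xs) \<subseteq> E \<longleftrightarrow>
    successively (\<lambda>a b. {a, b} \<in> E) xs \<and> {last xs, hd xs} \<in> E"
proof
  assume sub: "edges (cycle_graph xs) \<subseteq> E"
  have *: "{xs ! i, xs ! (Suc i mod length xs)} \<in> E" if "i < length xs" for i
    using sub that by (auto simp: edges_cycle_graph)
  show "successively (\<lambda>a b. {a, b} \<in> E) xs \<and> {last xs, hd xs} \<in> E"
    unfolding successively_conv_nth
  proof (intro conjI allI impI)
    fix i assume "Suc i < length xs"
    then show "{xs ! i, xs ! Suc i} \<in> E" using *[of i] by simp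
  next
    show "{last xs, hd xs} \<in> E" using *[of "length xs - 1"] assms
      by (simp add: last_conv_nth hd_conv_nth)
  qed
next
  assume R: "successively (\<lambda>a b. {a, b} \<in> E) xs \<and> {last xs, hd xs} \<in> E"
  show "edges (cycle_graph xs) \<subseteq> E"
    unfolding edges_cycle_graph
  proof safe
    fix i assume i: "i < length xs"
    show "{xs ! i, xs ! (Suc i mod length xs)} \<in> E"
    proof (cases "Suc i = length xs")
      case True
      then have "i = length xs - 1" by simp
      then show ?thesis using R assms True by (simp add: last_conv_nth hd_conv_nth)
    next
      case False
      then show ?thesis using R i by (simp add: successively_conv_nth)
    qed
  qed
qed

lemma card_edges_cycle_graph:
  assumes "distinct xs" "3 \<le> length xs"
  shows "card (edges (cycle_graph xs)) = length xs"
proof -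
  let ?n = "length xs"
  have "inj_on (\<lambda>i. {xs ! i, xs ! (Suc i mod ?n)}) {..<?n}"
  proof (rule inj_onI)
    fix i j assume ij: "i \<in> {..<?n}" "j \<in> {..<?n}"
      and eq: "{xs ! i, xs ! (Suc i mod ?n)} = {xs ! j, xs ! (Suc j mod ?n)}"
    have lt: "Suc i mod ?n < ?n" "Suc j mod ?n < ?n" using ij by (auto intro: mod_less_divisor)
    have "i = j \<or> i = Suc j mod ?n \<and> j = Suc i mod ?n"
      using eq ij lt nth_eq_iff_index_eq[OF assms(1)] by (auto simp: doubleton_eq_iff)
    then show "i = j" using ij assms(2) by (auto simp: mod_Suc split: if_splits)
  qed
  then show ?thesis by (simp add: edges_cycle_graph card_image)
qed

text \<open>Edges are added one at a time. When the new edge joins two vertices of the same colour, either they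
are in different components, and flipping the colours of one component repairs the colouring, or a
path joins them; its colours alternate, so the new edge closes it to an odd cycle.\<close>

lemma two_colourable_if_no_odd_cycle:
  assumes "finite E" "\<forall>e\<in>E. card e = 2"
    and "\<nexists>xs. distinct xs \<and> 3 \<le> length xs \<and> odd (length xs) \<and> edges (cycle_graph xs) \<subseteq> E"
  shows "\<exists>f. proper_two_colouring E f"
  using assms
proof (induction E rule: finite_induct)
  case empty
  then show ?case by (simp add: proper_two_colouring_def)
next
  case (insert e F)
  from insert.prems insert.IH obtain f where f: "proper_two_colouring F f" by blast
  obtain u v where e: "e = {u, v}" "u \<noteq> v"
    using insert.prems(1) by (metis card_2_iff insertI1)
  define R where "R = {(a, b). {a, b} \<in> F}"
  have symR: "(a, b) \<in> R \<longleftrightarrow> (b, a) \<in> R" for a b by (simp add: R_def insert_commute)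
  show ?case
  proof (cases "f u = f v \<and> (u, v) \<in> R\<^sup>*")
    case True
    then obtain xs where xs: "xs \<noteq> []" "hd xs = u" "last xs = v" "distinct xs"
      "successively (\<lambda>a b. (a, b) \<in> R) xs" using rtrancl_distinct_path[of u v R] by blast
    have "successively (\<lambda>a b. f a \<noteq> f b) xs"
      using xs(5) by (rule successively_mono) (use f in \<open>auto simp: R_def proper_two_colouring_def\<close>)
    then have "odd (length xs)" using alternating_list_parity xs True by metis
    moreover have "length xs \<noteq> 1" using xs e by (auto simp: length_Suc_conv)
    ultimately have "3 \<le> length xs" by presburger
    moreover have "edges (cycle_graph xs) \<subseteq> insert e F"
      unfolding edges_cycle_graph_subset_iff[OF xs(1)]
    proof
      show "successively (\<lambda>a b. {a, b} \<in> insert e F) xs"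
        using xs(5) by (rule successively_mono) (simp add: R_def)
    qed (use xs e in \<open>simp add: insert_commute\<close>)
    ultimately show ?thesis using insert.prems(2) xs \<open>odd (length xs)\<close> by blast
  next
    case False
    define h where "h w = (f w \<noteq> (f u = f v \<and> (u, w) \<in> R\<^sup>*))" for w
    have "h a \<noteq> h b" if "{a, b} \<in> F" for a b
    proof -
      have "(u, a) \<in> R\<^sup>* \<longleftrightarrow> (u, b) \<in> R\<^sup>*"
        using that symR by (auto simp: R_def intro: rtrancl_into_rtrancl)
      then show ?thesis using f that by (auto simp: h_def proper_two_colouring_def)
    qed
    moreover have "h u \<noteq> h v" using False by (auto simp: h_def)
    ultimately have "proper_two_colouring (insert e F) h"
      by (auto simp: proper_two_colouring_def e doubleton_eq_iff)
    then show ?thesis by blast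
  qed
qed

lemma odd_cycle_not_two_colourable:
  assumes "odd (length xs)" "edges (cycle_graph xs) \<subseteq> E" "proper_two_colouring E f"
  shows False
proof -
  have ne: "xs \<noteq> []" using assms(1) by auto
  have s: "successively (\<lambda>a b. {a, b} \<in> E) xs" "{last xs, hd xs} \<in> E"
    using assms(2) edges_cycle_graph_subset_iff[OF ne] by auto
  have "successively (\<lambda>a b. f a \<noteq> f b) xs"
    using s(1) by (rule successively_mono) (use assms(3) in \<open>auto simp: proper_two_colouring_def\<close>)
  then show False
    using alternating_list_parity[OF _ ne] s(2) assms by (auto simp: proper_two_colouring_def)
qed

text \<open>Rotations make it possible to let a cycle start at any prescribed vertex.\<close>

lemma cycle_graph_rotate1: "cycle_graph (rotate1 xs) = cycle_graph xs"
proof -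
  let ?n = "length xs"
  have surj: "(\<lambda>i. Suc i mod ?n) ` {..<?n} = {..<?n}"
  proof (intro set_eqI iffI)
    fix j assume "j \<in> {..<?n}"
    then show "j \<in> (\<lambda>i. Suc i mod ?n) ` {..<?n}"
      by (intro image_eqI[of _ _ "if j = 0 then ?n - 1 else j - 1"]) auto
  qed (auto intro: mod_less_divisor)
  have "rotate1 xs ! i = xs ! (Suc i mod ?n)" if "i < ?n" for i
    using that by (simp add: nth_rotate1)
  moreover have "Suc i mod ?n < ?n" if "i < ?n" for i
    using that by (intro mod_less_divisor) linarith
  ultimately have "edges (cycle_graph (rotate1 xs)) =
      (\<lambda>i. {xs ! i, xs ! (Suc i mod ?n)}) ` (\<lambda>i. Suc i mod ?n) ` {..<?n}"
    unfolding edges_cycle_graph image_image by (intro image_cong) simp_all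
  then have "edges (cycle_graph (rotate1 xs)) = edges (cycle_graph xs)"
    by (simp add: surj edges_cycle_graph)
  then show ?thesis by (simp add: cycle_graph_def)
qed

lemma cycle_graph_rotate: "cycle_graph (rotate m xs) = cycle_graph xs"
  by (induction m) (simp_all add: cycle_graph_rotate1)

lemma finite_edges: "simple_graph G \<Longrightarrow> finite (edges G)"
  unfolding simple_graph_def by (auto intro: finite_subset[of _ "Pow (verts G)"])

lemma edge_endpoints:
  assumes "simple_graph G" "{a, b} \<in> edges G"
  shows "a \<in> verts G" "b \<in> verts G" "a \<noteq> b"
proof -
  have "{a, b} \<subseteq> verts G" "card {a, b} = 2" using assms by (auto simp: simple_graph_def)
  then show "a \<in> verts G" "b \<in> verts G" "a \<noteq> b" by (auto simp: card_insert_if split: if_splits)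
qed

lemma edge_cases:
  assumes "simple_graph G" "e \<in> edges G"
  obtains a b where "e = {a, b}" "a \<noteq> b" "a \<in> verts G" "b \<in> verts G"
proof -
  have "card e = 2" "e \<subseteq> verts G" using assms by (auto simp: simple_graph_def)
  then obtain a b where "e = {a, b}" "a \<noteq> b" by (auto simp: card_2_iff)
  then show thesis using that \<open>e \<subseteq> verts G\<close> by blast
qed

section \<open>Graphs with a single odd cycle\<close>

locale unique_odd_cycle =
  fixes G C :: "'a ugraph"
  assumes simple: "simple_graph G"
    and odd_cycle: "odd_cycle_of G C"
    and unique: "odd_cycle_of G D \<Longrightarrow> D = C"
begin

lemma odd_cycle_from:
  assumes "c \<in> verts C"
  obtains xs where "distinct xs" "3 \<le> length xs" "odd (length xs)" "C = cycle_graph xs" "xs ! 0 = c"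
proof -
  obtain ys where ys: "distinct ys" "3 \<le> length ys" "C = cycle_graph ys"
    using odd_cycle by (auto simp: odd_cycle_of_def cycle_of_def)
  have "odd (length ys)" using odd_cycle ys card_edges_cycle_graph[of ys] by (simp add: odd_cycle_of_def)
  obtain m where m: "m < length ys" "ys ! m = c"
    using assms ys by (auto simp: cycle_graph_def in_set_conv_nth)
  show thesis
  proof (rule that[of "rotate m ys"])
    show "rotate m ys ! 0 = c" using m by (subst nth_rotate) auto
  qed (use ys \<open>odd (length ys)\<close> in \<open>auto simp: cycle_graph_rotate\<close>)
qed

lemma cycle_subset: "verts C \<subseteq> verts G" "edges C \<subseteq> edges G"
  using odd_cycle by (auto simp: odd_cycle_of_def cycle_of_def subgraph_def)

lemma finite_verts: "finite (verts G)"
  using simple by (simp add: simple_graph_def)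

lemma finite_cycle: "finite (verts C)"
  using cycle_subset finite_verts finite_subset by blast

lemma cycle_nonempty: "verts C \<noteq> {}"
  using odd_cycle by (auto simp: odd_cycle_of_def cycle_of_def cycle_graph_def)

lemma card_cycle: "card (verts C) = 2 * (card (verts C) div 2) + 1" "3 \<le> card (verts C)"
proof -
  obtain xs where xs: "distinct xs" "3 \<le> length xs" "odd (length xs)" "C = cycle_graph xs"
    using cycle_nonempty odd_cycle_from by blast
  then have "card (verts C) = length xs" by (simp add: cycle_graph_def distinct_card)
  with xs show "card (verts C) = 2 * (card (verts C) div 2) + 1" "3 \<le> card (verts C)" by simp_all
qed

lemma edge_of_cycle_subset: "{a, b} \<in> edges C \<Longrightarrow> a \<in> verts C"
proof -
  assume e: "{a, b} \<in> edges C"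
  obtain xs where xs: "3 \<le> length xs" "C = cycle_graph xs"
    using cycle_nonempty odd_cycle_from by blast
  have "Suc i mod length xs < length xs" for i using xs(1) by (intro mod_less_divisor) linarith
  then have "\<Union>(edges C) \<subseteq> verts C"
    unfolding xs(2) by (auto simp: cycle_graph_def)
  then show "a \<in> verts C" using e by blast
qed

text \<open>Each edge of the unique odd cycle is indispensable for all odd cycles, so deleting it makes the
graph bipartite. The deleted edge has to be monochromatic, since the graph with the edge is not
bipartite. These colourings are the only way in which the uniqueness of the cycle is exploited.\<close>

lemma two_colouring_minus_cycle_edge:
  assumes "e \<in> edges C"
  obtains f where "proper_two_colouring (edges G - {e}) f"
    and "\<And>a b. e = {a, b} \<Longrightarrow> f a = f b"
proof -
  have "\<exists>f. proper_two_colouring (edges G - {e}) f"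
  proof (rule two_colourable_if_no_odd_cycle)
    show "finite (edges G - {e})" using finite_edges[OF simple] by simp
    show "\<forall>e\<in>edges G - {e}. card e = 2" using simple by (auto simp: simple_graph_def)
    show "\<nexists>xs. distinct xs \<and> 3 \<le> length xs \<and> odd (length xs) \<and>
        edges (cycle_graph xs) \<subseteq> edges G - {e}"
    proof safe
      fix xs assume xs: "distinct xs" "3 \<le> length xs" "odd (length xs)"
        "edges (cycle_graph xs) \<subseteq> edges G - {e}"
      have "set xs \<subseteq> verts G"
      proof
        fix x assume "x \<in> set xs"
        then obtain i where i: "i < length xs" "x = xs ! i" by (auto simp: in_set_conv_nth)
        then have "{x, xs ! (Suc i mod length xs)} \<in> edges G"
          using xs(4) by (auto simp: edges_cycle_graph)
        then show "x \<in> verts G" using edge_endpoints[OF simple] by blast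
      qed
      then have "odd_cycle_of G (cycle_graph xs)"
        using xs card_edges_cycle_graph[of xs]
        by (auto simp: odd_cycle_of_def cycle_of_def subgraph_def cycle_graph_def)
      then show False using unique xs(4) assms by blast
    qed
  qed
  then obtain f where f: "proper_two_colouring (edges G - {e}) f" ..
  have "f a = f b" if e: "e = {a, b}" for a b
  proof (rule ccontr)
    assume "f a \<noteq> f b"
    with f have "proper_two_colouring (edges G) f"
      by (auto simp: proper_two_colouring_def e doubleton_eq_iff)
    moreover obtain xs where "odd (length xs)" "C = cycle_graph xs"
      using cycle_nonempty odd_cycle_from by blast
    ultimately show False
      using odd_cycle_not_two_colourable cycle_subset by blast
  qed
  with f show thesis by (rule that)
qed

lemma two_colouring_minus_edge_at:
  assumes c: "c \<in> verts C"
  obtains d f where "{c, d} \<in> edges C" "proper_two_colouring (edges G - {{c, d}}) f"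
proof -
  obtain xs where xs: "distinct xs" "3 \<le> length xs" "odd (length xs)" "C = cycle_graph xs" "xs ! 0 = c"
    using odd_cycle_from[OF c] .
  have e: "{c, xs ! 1} \<in> edges C" unfolding xs(4) edges_cycle_graph using xs(2,5)
    by (intro image_eqI[of _ _ 0]) auto
  then obtain f where "proper_two_colouring (edges G - {{c, xs ! 1}}) f"
    using two_colouring_minus_cycle_edge by blast
  with e show thesis by (rule that)
qed

text \<open>The part of the graph hanging at a vertex \<open>c\<close> of the cycle. Take two-colourings of the graph without
the first and without the second cycle edge at \<open>c\<close>. Whether the two agree at a vertex does not change
along any edge but these two, and changes along these two. Hence the vertices that behave like
\<open>c\<close> form a set that meets the cycle in \<open>c\<close> only and that can be left only along the two cycle edges at
\<open>c\<close>; in particular, no path outside the cycle joins different cycle vertices.\<close>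

lemma piece_hanging_at_cycle_vertex:
  assumes c: "c \<in> verts C"
  obtains P and f :: "'a \<Rightarrow> bool" where "P \<inter> verts C = {c}"
    and "\<forall>a b. {a, b} \<in> edges G \<and> a \<in> P \<and> ({a, b} \<notin> edges C \<or> a \<noteq> c) \<longrightarrow> b \<in> P \<and> f a \<noteq> f b"
proof -
  obtain xs where xs: "distinct xs" "3 \<le> length xs" "odd (length xs)" "C = cycle_graph xs" "xs ! 0 = c"
    using odd_cycle_from[OF c] .
  let ?n = "length xs"
  have edge: "{xs ! i, xs ! Suc i} \<in> edges C" if "Suc i < ?n" for i
    using that unfolding xs(4) edges_cycle_graph by (intro image_eqI[of _ _ i]) auto
  define e1 where "e1 = {c, xs ! 1}"
  define e2 where "e2 = {c, xs ! (?n - 1)}"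
  have e1C: "e1 \<in> edges C" using edge[of 0] xs by (simp add: e1_def)
  have e2C: "e2 \<in> edges C" unfolding e2_def xs(4) edges_cycle_graph
    using xs by (intro image_eqI[of _ _ "?n - 1"]) (auto simp: insert_commute)
  have nth_inj: "xs ! i = xs ! j \<longleftrightarrow> i = j" if "i < ?n" "j < ?n" for i j
    using nth_eq_iff_index_eq[OF xs(1) that] .
  have c_nth: "c = xs ! i \<longleftrightarrow> i = 0" if "i < ?n" for i
    using nth_inj[of i 0] that xs by fastforce
  have "xs ! 1 \<noteq> xs ! (?n - 1)" using nth_inj[of 1 "?n - 1"] xs by auto
  then have e12: "e1 \<noteq> e2" using c_nth[of 1] xs(2) by (auto simp: e1_def e2_def doubleton_eq_iff)
  obtain f1 where f1: "proper_two_colouring (edges G - {e1}) f1" "\<And>a b. e1 = {a, b} \<Longrightarrow> f1 a = f1 b"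
    using two_colouring_minus_cycle_edge[OF e1C] by blast
  obtain f2 where f2: "proper_two_colouring (edges G - {e2}) f2" "\<And>a b. e2 = {a, b} \<Longrightarrow> f2 a = f2 b"
    using two_colouring_minus_cycle_edge[OF e2C] by blast
  define g where "g u = (f1 u = f2 u)" for u
  have g_edge: "g a = g b" if "{a, b} \<in> edges G" "{a, b} \<noteq> e1" "{a, b} \<noteq> e2" for a b
    using f1(1) f2(1) that by (auto simp: g_def proper_two_colouring_def)
  have g1: "g c \<noteq> g (xs ! 1)"
  proof -
    have "f1 c = f1 (xs ! 1)" using f1(2) by (simp add: e1_def)
    moreover have "f2 c \<noteq> f2 (xs ! 1)"
      using f2(1) e1C e12 cycle_subset by (auto simp: e1_def proper_two_colouring_def)
    ultimately show ?thesis by (auto simp: g_def)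
  qed
  \<comment> \<open>The remaining edges of the cycle form a path from \<open>xs ! 1\<close> to the other neighbour of \<open>c\<close>.\<close>
  have g_other: "g (xs ! Suc i) = g (xs ! 1)" if "Suc i < ?n" for i
    using that
  proof (induction i)
    case (Suc i)
    have "g (xs ! Suc i) = g (xs ! Suc (Suc i))"
    proof (rule g_edge)
      have "c \<noteq> xs ! Suc i" "c \<noteq> xs ! Suc (Suc i)" using c_nth Suc.prems by auto
      then show "{xs ! Suc i, xs ! Suc (Suc i)} \<noteq> e1" "{xs ! Suc i, xs ! Suc (Suc i)} \<noteq> e2"
        by (auto simp: e1_def e2_def doubleton_eq_iff)
      show "{xs ! Suc i, xs ! Suc (Suc i)} \<in> edges G" using edge[of "Suc i"] Suc.prems cycle_subset by blast
    qed
    with Suc show ?case by simp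
  qed simp
  define P where "P = {u. g u = g c}"
  have P: "P \<inter> verts C = {c}"
  proof -
    have "u = c" if "u \<in> P" "u \<in> verts C" for u
    proof -
      have "u \<in> verts C" using that by simp
      then obtain i where i: "i < ?n" "u = xs ! i"
        unfolding xs(4) by (auto simp: cycle_graph_def in_set_conv_nth)
      show ?thesis
      proof (cases i)
        case (Suc j)
        then show ?thesis using g_other[of j] i that(1) g1 by (auto simp: P_def)
      qed (use i xs in simp)
    qed
    then show ?thesis using c by (auto simp: P_def)
  qed
  show thesis
  proof (rule that[of P f1, OF P], intro allI impI)
    fix a b assume ab: "{a, b} \<in> edges G \<and> a \<in> P \<and> ({a, b} \<notin> edges C \<or> a \<noteq> c)"
    have in_C: "xs ! 1 \<in> verts C" "xs ! (?n - 1) \<in> verts C"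
      using xs(2) unfolding xs(4) by (auto simp: cycle_graph_def)
    have "c \<noteq> xs ! 1" "c \<noteq> xs ! (?n - 1)"
      using c_nth[of 1] c_nth[of "?n - 1"] xs(2) by auto
    moreover have "u = c" if "u \<in> P" "u \<in> verts C" for u
      using P that by auto
    ultimately have "xs ! 1 \<notin> P" "xs ! (?n - 1) \<notin> P" using in_C by metis+
    then have "{a, b} \<noteq> e1" "{a, b} \<noteq> e2"
      using ab e1C e2C by (auto simp: e1_def e2_def doubleton_eq_iff)
    then show "b \<in> P \<and> f1 a \<noteq> f1 b"
      using g_edge[of a b] ab f1(1) by (auto simp: P_def proper_two_colouring_def)
  qed
qed

text \<open>Colour the graph without an edge of the cycle at \<open>c\<close>. Colours alternate along the rest of the cycle,
so every second vertex after the one next to \<open>c\<close> has the same colour, and two of these vertices can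
only be adjacent through the removed edge, which contains \<open>c\<close>. That \<open>c\<close> can be avoided is what shows
that no cycle vertex belongs to the core.\<close>

lemma independent_half_of_cycle:
  assumes c: "c \<in> verts C"
  obtains I where "I \<subseteq> verts C - {c}" "independent G I" "2 * card I + 1 = card (verts C)"
proof -
  obtain xs where xs: "distinct xs" "3 \<le> length xs" "odd (length xs)" "C = cycle_graph xs" "xs ! 0 = c"
    using odd_cycle_from[OF c] .
  obtain k where k: "length xs = 2 * k + 1" using xs(3) oddE by blast
  have edge: "{xs ! i, xs ! Suc i} \<in> edges C" if "Suc i < length xs" for i
    using that unfolding xs(4) edges_cycle_graph by (intro image_eqI[of _ _ i]) auto
  define e where "e = {c, xs ! 1}"
  have eC: "e \<in> edges C" using edge[of 0] xs by (simp add: e_def)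
  obtain f where f: "proper_two_colouring (edges G - {e}) f"
    using two_colouring_minus_cycle_edge[OF eC] by blast
  have c_nth: "c = xs ! i \<longleftrightarrow> i = 0" if "i < length xs" for i
    using nth_eq_iff_index_eq[OF xs(1), of i 0] that xs by fastforce
  have step: "f (xs ! Suc i) \<noteq> f (xs ! Suc (Suc i))" if "Suc (Suc i) < length xs" for i
  proof -
    have "c \<noteq> xs ! Suc i" "c \<noteq> xs ! Suc (Suc i)" using c_nth that by auto
    then have "{xs ! Suc i, xs ! Suc (Suc i)} \<noteq> e" by (auto simp: e_def doubleton_eq_iff)
    then show ?thesis using edge[OF that] cycle_subset f by (auto simp: proper_two_colouring_def)
  qed
  have same: "f (xs ! (2 * j + 2)) = f (xs ! 2)" if "j < k" for j
    using that
  proof (induction j)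
    case (Suc j)
    then show ?case using step[of "2 * j + 1"] step[of "2 * j + 2"] k by auto
  qed (simp add: numeral_2_eq_2)
  define I where "I = (\<lambda>j. xs ! (2 * j + 2)) ` {..<k}"
  have cI: "c \<notin> I"
  proof
    assume "c \<in> I"
    then obtain j where "j < k" "c = xs ! (2 * j + 2)" by (auto simp: I_def)
    then show False using c_nth[of "2 * j + 2"] k by simp
  qed
  have sub: "I \<subseteq> verts C" unfolding I_def xs(4) cycle_graph_def using k by auto
  have "{u, v} \<notin> edges G" if "u \<in> I" "v \<in> I" for u v
  proof
    assume "{u, v} \<in> edges G"
    moreover have "{u, v} \<noteq> e" using that cI by (auto simp: e_def doubleton_eq_iff)
    moreover have "f u = f v" using that same by (auto simp: I_def)
    ultimately show False using f by (auto simp: proper_two_colouring_def)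
  qed
  then have "independent G I" using sub cycle_subset by (auto simp: independent_def)
  moreover have "card I = k" unfolding I_def
    using nth_eq_iff_index_eq[OF xs(1)] k by (subst card_image) (auto intro!: inj_onI)
  moreover have "card (verts C) = 2 * k + 1"
    using xs(1,4) k by (simp add: cycle_graph_def distinct_card)
  ultimately show thesis using that[of I] sub cI by auto
qed

lemma matching_of_cycle_minus_vertex:
  assumes c: "c \<in> verts C"
  obtains M where "matching G M" "\<Union>M \<subseteq> verts C - {c}" "2 * card M + 1 = card (verts C)"
proof -
  obtain xs where xs: "distinct xs" "3 \<le> length xs" "odd (length xs)" "C = cycle_graph xs" "xs ! 0 = c"
    using odd_cycle_from[OF c] .
  obtain k where k: "length xs = 2 * k + 1" using xs(3) oddE by blast
  have edge: "{xs ! i, xs ! Suc i} \<in> edges C" if "Suc i < length xs" for i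
    using that unfolding xs(4) edges_cycle_graph by (intro image_eqI[of _ _ i]) auto
  have nth_inj: "xs ! i = xs ! j \<longleftrightarrow> i = j" if "i < length xs" "j < length xs" for i j
    using nth_eq_iff_index_eq[OF xs(1) that] .
  define m where "m j = {xs ! (2 * j + 1), xs ! (2 * j + 2)}" for j
  have disj: "disjnt (m i) (m j)" if "i < k" "j < k" "i \<noteq> j" for i j
    using that k nth_inj by (auto simp: m_def disjnt_def)
  have "inj_on m {..<k}"
    using disj by (intro inj_onI) (force simp: disjnt_def m_def)
  then have "card (m ` {..<k}) = k" by (simp add: card_image)
  moreover have "matching G (m ` {..<k})"
    unfolding matching_def using disj edge cycle_subset k by (auto simp: pairwise_def m_def)
  moreover have "\<Union>(m ` {..<k}) \<subseteq> verts C - {c}"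
  proof -
    have "xs ! i \<in> verts C - {c}" if "i < length xs" "i \<noteq> 0" for i
      using that nth_inj[of i 0] xs(2,5) unfolding xs(4) by (fastforce simp: cycle_graph_def)
    then have "m j \<subseteq> verts C - {c}" if "j < k" for j using k that by (simp add: m_def)
    then show ?thesis by blast
  qed
  moreover have "card (verts C) = 2 * k + 1"
    using xs(1,4) k by (simp add: cycle_graph_def distinct_card)
  ultimately show thesis using that[of "m ` {..<k}"] by simp
qed

end

section \<open>Independence number and matching number\<close>

lemma finite_independent_sets: "simple_graph G \<Longrightarrow> finite {S. independent G S}"
  by (rule finite_subset[of _ "Pow (verts G)"]) (auto simp: independent_def simple_graph_def)

lemma finite_matchings: "simple_graph G \<Longrightarrow> finite {M. matching G M}"
  using finite_edges by (auto simp: matching_def intro: finite_subset[of _ "Pow (edges G)"])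

lemma card_le_independence_number:
  "simple_graph G \<Longrightarrow> independent G S \<Longrightarrow> card S \<le> independence_number G"
  unfolding independence_number_def using finite_independent_sets[of G] by (intro Max_ge) auto

lemma card_le_matching_number:
  "simple_graph G \<Longrightarrow> matching G M \<Longrightarrow> card M \<le> matching_number G"
  unfolding matching_number_def using finite_matchings[of G] by (intro Max_ge) auto

lemma maximum_independent_exists:
  assumes "simple_graph G"
  shows "\<exists>S. maximum_independent G S"
proof -
  have "independent G {}" by (simp add: independent_def)
  then have "independence_number G \<in> card ` {S. independent G S}"
    unfolding independence_number_def
    using finite_independent_sets[OF assms] by (intro Max_in) auto
  then show ?thesis by (auto simp: maximum_independent_def)
qed

lemma maximum_matching_exists:
  assumes "simple_graph G"
  shows "\<exists>M. matching G M \<and> card M = matching_number G"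
proof -
  have "matching G {}" by (simp add: matching_def)
  then have "matching_number G \<in> card ` {M. matching G M}"
    unfolding matching_number_def
    using finite_matchings[OF assms] by (intro Max_in) auto
  then show ?thesis by auto
qed

lemma card_disjoint_family_le_transversal:
  assumes "pairwise disjnt M" "finite W" "\<And>e. e \<in> M \<Longrightarrow> e \<inter> W \<noteq> {}"
  shows "card M \<le> card W"
proof -
  define w where "w e = (SOME x. x \<in> e \<inter> W)" for e
  have w: "w e \<in> e \<inter> W" if "e \<in> M" for e
    unfolding w_def using assms(3)[OF that] by (rule someI_ex[OF ex_in_conv[THEN iffD2]])
  have "inj_on w M"
  proof (rule inj_onI, rule ccontr)
    fix d e assume "d \<in> M" "e \<in> M" "w d = w e" "d \<noteq> e"
    then have "w d \<in> d \<inter> e" "disjnt d e"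
      using w[of d] w[of e] assms(1) by (auto dest: pairwiseD)
    then show False by (auto simp: disjnt_def)
  qed
  then show ?thesis using card_inj_on_le[of w M W] w assms(2) by blast
qed

text \<open>Each matching edge has an endpoint outside the independent set, and these endpoints are distinct.\<close>

lemma card_independent_plus_matching_le:
  assumes "simple_graph G" "independent G S" "matching G M" "\<Union>M \<subseteq> W" "finite W"
  shows "card (S \<inter> W) + card M \<le> card W"
proof -
  have "e \<inter> (W - S) \<noteq> {}" if "e \<in> M" for e
  proof -
    have "e \<in> edges G" using assms(3) that by (auto simp: matching_def)
    then obtain a b where "e = {a, b}" using edge_cases[OF assms(1)] by blast
    then show ?thesis using assms(2,4) \<open>e \<in> edges G\<close> that by (auto simp: independent_def)
  qed
  then have "card M \<le> card (W - S)"
    using assms(3,5) by (intro card_disjoint_family_le_transversal) (auto simp: matching_def)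
  moreover have "card W = card (S \<inter> W) + card (W - S)"
    using assms(5) card_Int_Diff[of W S] by (simp add: Int_commute)
  ultimately show ?thesis by simp
qed

text \<open>Matching edges inside \<open>Z\<close> use two vertices of \<open>Z\<close> each. When \<open>Z\<close> is the vertex set of an odd cycle,
this bound is one less than what a vertex cover of the cycle in place of \<open>Z\<close> would give.\<close>

lemma card_matching_le:
  assumes "simple_graph G" "matching G M" "finite Y" "finite Z"
    and cover: "\<And>e. e \<in> M \<Longrightarrow> e \<inter> Y \<noteq> {} \<or> e \<subseteq> Z"
  shows "card M \<le> card Y + card Z div 2"
proof -
  define A where "A = {e \<in> M. e \<inter> Y \<noteq> {}}"
  define B where "B = M - A"
  have finM: "finite M"
    using assms(2) finite_subset[OF _ finite_edges[OF assms(1)]] by (simp add: matching_def)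
  have M: "pairwise disjnt M" using assms(2) by (simp add: matching_def)
  have disj: "pairwise disjnt A" "pairwise disjnt B"
    by (rule pairwise_subset[OF M], auto simp: A_def B_def)+
  have "card A \<le> card Y"
    using disj(1) assms(3) by (intro card_disjoint_family_le_transversal) (auto simp: A_def)
  moreover have "2 * card B \<le> card Z"
  proof -
    have e2: "card e = 2" if "e \<in> B" for e
      using that assms(1,2) by (auto simp: B_def matching_def simple_graph_def)
    have "card (\<Union>B) = (\<Sum>e\<in>B. card e)"
      using disj(2) e2 by (intro card_Union_disjoint) (auto intro: card_ge_0_finite)
    also have "\<dots> = 2 * card B" using e2 by simp
    finally have "2 * card B = card (\<Union>B)" by simp
    also have "\<dots> \<le> card Z" using cover assms(4) by (intro card_mono) (auto simp: A_def B_def)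
    finally show ?thesis .
  qed
  moreover have "card M = card A + card B"
    using finM card_Int_Diff[of M A] by (simp add: A_def B_def Int_absorb1)
  ultimately show ?thesis by linarith
qed

lemma simple_graph_matching_verts:
  assumes "simple_graph G" "matching G M"
  shows "\<Union>M \<subseteq> verts G"
  using assms by (auto simp: matching_def simple_graph_def)

lemma independence_plus_matching_le:
  assumes "simple_graph G"
  shows "independence_number G + matching_number G \<le> card (verts G)"
proof -
  obtain S M where S: "independent G S" "card S = independence_number G"
    and M: "matching G M" "card M = matching_number G"
    using maximum_independent_exists[OF assms] maximum_matching_exists[OF assms]
    by (auto simp: maximum_independent_def)
  have "S \<inter> verts G = S" using S by (auto simp: independent_def)
  then show ?thesis
    using card_independent_plus_matching_le[OF assms S(1) M(1) simple_graph_matching_verts[OF assms M(1)]] S M assms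
    by (simp add: simple_graph_def)
qed

text \<open>Since the two numbers never add up to more than the number of vertices, one independent set and one
matching that are large enough together witness the Konig-Egervary property.\<close>

lemma konig_egervary_iff:
  assumes "simple_graph G"
  shows "konig_egervary G \<longleftrightarrow>
    (\<exists>S M. independent G S \<and> matching G M \<and> card (verts G) \<le> card S + card M)"
proof
  assume "konig_egervary G"
  then show "\<exists>S M. independent G S \<and> matching G M \<and> card (verts G) \<le> card S + card M"
    using maximum_independent_exists[OF assms] maximum_matching_exists[OF assms]
    unfolding konig_egervary_def maximum_independent_def by (metis le_refl)
next
  assume "\<exists>S M. independent G S \<and> matching G M \<and> card (verts G) \<le> card S + card M"
  then obtain S M where "independent G S" "matching G M" "card (verts G) \<le> card S + card M" by blast
  then show "konig_egervary G"
    using card_le_independence_number[OF assms, of S] card_le_matching_number[OF assms, of M]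
      independence_plus_matching_le[OF assms]
    unfolding konig_egervary_def by linarith
qed

lemma konig_egervary_del_vertex_iff:
  assumes "simple_graph G" "v \<in> verts G"
  shows "konig_egervary (del_vertex G v) \<longleftrightarrow>
    (\<exists>S M. independent G S \<and> matching G M \<and> v \<notin> S \<and> v \<notin> \<Union>M \<and>
      card (verts G) \<le> Suc (card S + card M))"
proof -
  have "simple_graph (del_vertex G v)"
    using assms(1) by (auto simp: simple_graph_def del_vertex_def)
  moreover have "independent (del_vertex G v) S \<longleftrightarrow> independent G S \<and> v \<notin> S" for S
    by (auto simp: independent_def del_vertex_def)
  moreover have "matching (del_vertex G v) M \<longleftrightarrow> matching G M \<and> v \<notin> \<Union>M" for M
    by (auto simp: matching_def del_vertex_def)
  moreover have "card (verts G) = Suc (card (verts (del_vertex G v)))"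
    using assms card_Suc_Diff1[of "verts G" v] by (simp add: del_vertex_def simple_graph_def)
  ultimately show ?thesis by (auto simp: konig_egervary_iff)
qed

lemma set_difference_le_critical_difference:
  "simple_graph G \<Longrightarrow> independent G I \<Longrightarrow> set_difference G I \<le> critical_difference G"
  unfolding critical_difference_def using finite_independent_sets[of G] by (intro Max_ge) auto

lemma maximum_critical_independent_exists:
  assumes "simple_graph G"
  shows "\<exists>X. maximum_critical_independent G X"
proof -
  let ?crit = "{A. critical_independent G A}"
  have fin: "finite ?crit"
    using finite_independent_sets[OF assms] by (rule rev_finite_subset) (auto simp: critical_independent_def)
  have "independent G {}" by (simp add: independent_def)
  then have "critical_difference G \<in> set_difference G ` {I. independent G I}"
    unfolding critical_difference_def
    using finite_independent_sets[OF assms] by (intro Max_in) auto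
  then have "?crit \<noteq> {}" by (auto simp: critical_independent_def)
  then have "Max (card ` ?crit) \<in> card ` ?crit" using fin by (intro Max_in) auto
  then obtain X where X: "critical_independent G X" "card X = Max (card ` ?crit)" by auto
  have "card B \<le> card X" if "critical_independent G B" for B
    unfolding X(2) using fin that by (intro Max_ge) auto
  with X(1) show ?thesis by (auto simp: maximum_critical_independent_def)
qed

section \<open>The decomposition around a maximum critical independent set\<close>

locale critical_decomposition = unique_odd_cycle +
  fixes X :: "'a set"
  assumes not_konig_egervary: "\<not> konig_egervary G"
    and maximum_critical: "maximum_critical_independent G X"
begin

abbreviation "Y \<equiv> neighborhood G X"

abbreviation "H \<equiv> verts G - (X \<union> Y)"

lemma mem_neighborhood_iff: "u \<in> neighborhood G Z \<longleftrightarrow> (\<exists>z\<in>Z. {u, z} \<in> edges G)"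
  using edge_endpoints[OF simple] by (auto simp: neighborhood_def)

lemma edge_commute: "{a, b} \<in> edges G \<longleftrightarrow> {b, a} \<in> edges G"
  by (simp add: insert_commute)

lemma finite_subset_verts: "Z \<subseteq> verts G \<Longrightarrow> finite Z"
  using finite_verts finite_subset by blast

lemma neighborhood_subset_verts: "neighborhood G Z \<subseteq> verts G"
  by (auto simp: neighborhood_def)

lemma finite_neighborhood: "finite (neighborhood G Z)"
  using finite_subset_verts neighborhood_subset_verts by blast

lemma X_independent: "independent G X"
  using maximum_critical by (simp add: maximum_critical_independent_def critical_independent_def)

lemma X_subset: "X \<subseteq> verts G"
  using X_independent by (simp add: independent_def)

lemma finite_X: "finite X"
  using X_subset finite_subset_verts by blast

lemma X_Y_disjoint: "X \<inter> Y = {}"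
  using X_independent by (auto simp: mem_neighborhood_iff independent_def)

lemma critical: "independent G I \<Longrightarrow> set_difference G I \<le> int (card X) - int (card Y)"
  using set_difference_le_critical_difference[OF simple] maximum_critical
  by (simp add: maximum_critical_independent_def critical_independent_def set_difference_def)

lemma larger_independent_not_critical:
  assumes "independent G I" "card X < card I"
  shows "set_difference G I < int (card X) - int (card Y)"
proof (rule ccontr)
  assume "\<not> ?thesis"
  then have "critical_independent G I"
    using critical[OF assms(1)] assms(1) maximum_critical
    by (simp add: maximum_critical_independent_def critical_independent_def set_difference_def)
  then show False using maximum_critical assms(2) by (auto simp: maximum_critical_independent_def)
qed

text \<open>If \<open>R\<close> had fewer neighbours in \<open>X\<close> than elements, deleting those neighbours from \<open>X\<close> would remove all
of \<open>R\<close> from the neighbourhood and so increase the difference.\<close>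

lemma hall_Y:
  assumes "R \<subseteq> Y"
  shows "card R \<le> card (neighborhood G R \<inter> X)"
proof -
  let ?I = "X - neighborhood G R"
  have "independent G ?I" using X_independent by (auto simp: independent_def)
  moreover have "neighborhood G ?I \<subseteq> Y - R"
  proof
    fix u assume "u \<in> neighborhood G ?I"
    then obtain z where z: "z \<in> ?I" "{u, z} \<in> edges G" by (auto simp: mem_neighborhood_iff)
    then have "u \<notin> R" using edge_commute[of u z] by (auto simp: mem_neighborhood_iff)
    then show "u \<in> Y - R" using z by (auto simp: mem_neighborhood_iff)
  qed
  then have "card (neighborhood G ?I) \<le> card (Y - R)"
    using finite_neighborhood by (intro card_mono) auto
  ultimately have "int (card ?I) - int (card (Y - R)) \<le> int (card X) - int (card Y)"
    using critical[of ?I] by (simp add: set_difference_def)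
  moreover have "card X = card (neighborhood G R \<inter> X) + card ?I"
    using card_Int_Diff[OF finite_X, of "neighborhood G R"] by (simp add: Int_commute)
  moreover have "card Y = card R + card (Y - R)"
    using assms card_Int_Diff[of Y R] finite_neighborhood by (simp add: Int_absorb1)
  ultimately show ?thesis by linarith
qed

lemma matching_Y_into_X:
  obtains \<psi> where "inj_on \<psi> Y" "\<And>t. t \<in> Y \<Longrightarrow> \<psi> t \<in> X \<and> {t, \<psi> t} \<in> edges G"
proof -
  have "\<exists>\<psi>. inj_on \<psi> Y \<and> (\<forall>t\<in>Y. \<psi> t \<in> {x \<in> X. {t, x} \<in> edges G})"
  proof (rule hall_distinct_representatives)
    fix R assume R: "R \<subseteq> Y"
    have "(\<Union>t\<in>R. {x \<in> X. {t, x} \<in> edges G}) = neighborhood G R \<inter> X"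
      using edge_commute by (auto simp: mem_neighborhood_iff)
    then show "card R \<le> card (\<Union>t\<in>R. {x \<in> X. {t, x} \<in> edges G})"
      using hall_Y[OF R] by simp
  qed (use finite_neighborhood finite_X in auto)
  then show thesis using that by blast
qed

lemma matching_of_injection:
  assumes "inj_on \<psi> Z" "\<psi> ` Z \<inter> Z = {}" "\<And>t. t \<in> Z \<Longrightarrow> {t, \<psi> t} \<in> edges G"
  shows "matching G ((\<lambda>t. {t, \<psi> t}) ` Z)" "card ((\<lambda>t. {t, \<psi> t}) ` Z) = card Z"
proof -
  have disj: "disjnt {s, \<psi> s} {t, \<psi> t}" if "s \<in> Z" "t \<in> Z" "s \<noteq> t" for s t
  proof -
    have "\<psi> s \<notin> Z" "\<psi> t \<notin> Z" "\<psi> s \<noteq> \<psi> t" using that assms(1,2) by (auto simp: inj_on_def)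
    then show ?thesis using that by (auto simp: disjnt_def)
  qed
  then show "matching G ((\<lambda>t. {t, \<psi> t}) ` Z)"
    using assms(3) by (auto simp: matching_def intro!: pairwise_imageI)
  have "inj_on (\<lambda>t. {t, \<psi> t}) Z"
  proof (rule inj_onI, rule ccontr)
    fix s t assume "s \<in> Z" "t \<in> Z" "{s, \<psi> s} = {t, \<psi> t}" "s \<noteq> t"
    then show False using disj[of s t] by (simp add: disjnt_def)
  qed
  then show "card ((\<lambda>t. {t, \<psi> t}) ` Z) = card Z" by (rule card_image)
qed

text \<open>Otherwise \<open>X \<union> I\<close> would be a critical independent set larger than \<open>X\<close>.\<close>

lemma H_strict_expansion:
  assumes I: "independent G I" "I \<subseteq> H" "I \<noteq> {}"
  shows "card I < card (neighborhood G I \<inter> H)"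
proof -
  have X_I: "{u, v} \<notin> edges G" if "u \<in> X" "v \<in> I" for u v
    using that I(2) edge_commute[of u v] by (auto simp: mem_neighborhood_iff)
  then have "independent G (X \<union> I)"
    using X_independent I edge_commute unfolding independent_def by blast
  moreover have fin: "finite I" using I finite_verts by (meson finite_Diff finite_subset)
  moreover have card_XI: "card (X \<union> I) = card X + card I"
    using I fin finite_X by (intro card_Un_disjoint) auto
  moreover have "0 < card I" using fin I by (simp add: card_gt_0_iff)
  ultimately have "set_difference G (X \<union> I) < int (card X) - int (card Y)"
    by (intro larger_independent_not_critical) auto
  moreover have "neighborhood G (X \<union> I) \<subseteq> Y \<union> (neighborhood G I \<inter> H)"
  proof
    fix u assume u: "u \<in> neighborhood G (X \<union> I)"
    have "u \<notin> X"
    proof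
      assume "u \<in> X"
      with u X_I show False using X_independent by (auto simp: mem_neighborhood_iff independent_def)
    qed
    then show "u \<in> Y \<union> (neighborhood G I \<inter> H)"
      using u subsetD[OF neighborhood_subset_verts u] by (auto simp: mem_neighborhood_iff)
  qed
  then have "card (neighborhood G (X \<union> I)) \<le> card (Y \<union> (neighborhood G I \<inter> H))"
    using finite_neighborhood by (intro card_mono) auto
  then have "card (neighborhood G (X \<union> I)) \<le> card Y + card (neighborhood G I \<inter> H)"
    using card_Un_le le_trans by blast
  ultimately show ?thesis using card_XI by (simp add: set_difference_def)
qed

text \<open>The form in which the expansion property is applied to colour classes: a class whose neighbours in
\<open>H\<close> all lie in a disjoint set is automatically independent.\<close>

lemma card_less_of_neighbours_in_H:
  assumes "Z \<subseteq> H" "Z \<noteq> {}" "finite Z'" "Z \<inter> Z' = {}"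
    and nbr: "\<And>x y. {x, y} \<in> edges G \<Longrightarrow> x \<in> Z \<Longrightarrow> y \<in> H \<Longrightarrow> y \<in> Z'"
  shows "card Z < card Z'"
proof -
  have "{u, v} \<notin> edges G" if "u \<in> Z" "v \<in> Z" for u v
    using nbr[of u v] that assms(1,4) by blast
  then have "independent G Z" using assms(1) unfolding independent_def by blast
  then have "card Z < card (neighborhood G Z \<inter> H)"
    using assms(1,2) by (intro H_strict_expansion)
  also have "\<dots> \<le> card Z'"
  proof (intro card_mono assms(3) subsetI)
    fix u assume u: "u \<in> neighborhood G Z \<inter> H"
    then obtain z where "z \<in> Z" "{z, u} \<in> edges G"
      using edge_commute by (auto simp: mem_neighborhood_iff)
    then show "u \<in> Z'" using nbr u by blast
  qed
  finally show ?thesis .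
qed

text \<open>Each of the two colour classes, if nonempty, would have to be smaller than the other.\<close>

lemma closed_bipartite_part_of_H_empty:
  fixes f :: "'a \<Rightarrow> bool"
  assumes "W \<subseteq> H"
    and closed: "\<And>a b. {a, b} \<in> edges G \<Longrightarrow> a \<in> W \<Longrightarrow> b \<in> H \<Longrightarrow> b \<in> W \<and> f a \<noteq> f b"
  shows "W = {}"
proof -
  define A where "A p = {a \<in> W. f a = p}" for p :: bool
  have A_W: "A p \<subseteq> W" for p by (auto simp: A_def)
  have less: "card (A p) < card (A (\<not> p))" if "A p \<noteq> {}" for p
  proof (rule card_less_of_neighbours_in_H)
    show "finite (A (\<not> p))" using A_W assms(1) by (intro finite_subset_verts) blast
    show "A p \<subseteq> H" using A_W assms(1) by blast
    show "A p \<inter> A (\<not> p) = {}" by (auto simp: A_def)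
    show "y \<in> A (\<not> p)" if "{x, y} \<in> edges G" "x \<in> A p" "y \<in> H" for x y
      using closed[OF that(1) _ that(3)] that(2) by (auto simp: A_def)
  qed (use that in simp)
  have "A p = {}" for p
  proof (rule ccontr)
    assume ne: "A p \<noteq> {}"
    from less[OF this] have "A (\<not> p) \<noteq> {}" by auto
    with less[OF ne] less[of "\<not> p"] show False by simp
  qed
  then show ?thesis by (auto simp: A_def)
qed

text \<open>If a cycle vertex \<open>c\<close> were missing from \<open>H\<close>, then the graph induced by \<open>H\<close> would be bipartite and
therefore empty. But then \<open>X\<close> together with a matching of \<open>Y\<close> into \<open>X\<close> would show that the graph is
Konig-Egervary.\<close>

lemma cycle_subset_H: "verts C \<subseteq> H"
proof
  fix c assume c: "c \<in> verts C"
  show "c \<in> H"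
  proof (rule ccontr)
    assume "c \<notin> H"
    obtain d f where f: "proper_two_colouring (edges G - {{c, d}}) f"
      using two_colouring_minus_edge_at[OF c] .
    have "H = {}"
    proof (rule closed_bipartite_part_of_H_empty)
      fix a b assume "{a, b} \<in> edges G" "a \<in> H" "b \<in> H"
      moreover have "{a, b} \<noteq> {c, d}"
        using \<open>c \<notin> H\<close> \<open>a \<in> H\<close> \<open>b \<in> H\<close> by (auto simp: doubleton_eq_iff)
      ultimately show "b \<in> H \<and> f a \<noteq> f b" using f by (auto simp: proper_two_colouring_def)
    qed simp
    then have "verts G = X \<union> Y" using X_subset neighborhood_subset_verts by blast
    then have "card (verts G) \<le> card X + card Y" using card_Un_le by metis
    moreover obtain \<psi> where \<psi>: "inj_on \<psi> Y" "\<And>t. t \<in> Y \<Longrightarrow> \<psi> t \<in> X \<and> {t, \<psi> t} \<in> edges G"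
      using matching_Y_into_X by blast
    have "\<psi> ` Y \<inter> Y = {}" using \<psi> X_Y_disjoint by blast
    note matching_of_injection[OF \<psi>(1) this]
    ultimately show False
      using not_konig_egervary konig_egervary_iff[OF simple] X_independent \<psi> by metis
  qed
qed

text \<open>An edge leading from a cycle vertex \<open>c\<close> into the piece hanging at \<open>c\<close> is impossible. In this piece let
\<open>A\<close> be the colour class of \<open>c\<close> and \<open>B\<close> the other one. The vertices of \<open>B\<close> and of \<open>A - {c}\<close> have no
neighbours outside the piece, so expansion gives \<open>|B| < |A|\<close> and then \<open>|A - {c}| < |B|\<close>, which leaves
no room for both.\<close>

lemma edge_at_cycle_vertex_in_H:
  assumes c: "c \<in> verts C" and b: "{c, b} \<in> edges G" "b \<in> H"
  shows "{c, b} \<in> edges C"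
proof (rule ccontr)
  assume notC: "{c, b} \<notin> edges C"
  obtain P and f :: "'a \<Rightarrow> bool" where P: "P \<inter> verts C = {c}"
    and step: "\<forall>a b. {a, b} \<in> edges G \<and> a \<in> P \<and> ({a, b} \<notin> edges C \<or> a \<noteq> c) \<longrightarrow> b \<in> P \<and> f a \<noteq> f b"
    by (rule piece_hanging_at_cycle_vertex[OF c])
  have cP: "c \<in> P" "c \<in> H" using P c cycle_subset_H by auto
  define A where "A = {a \<in> P \<inter> H. f a = f c}"
  define B where "B = {a \<in> P \<inter> H. f a \<noteq> f c}"
  have fin: "finite A" "finite B" 
    by (auto intro!: finite_subset_verts simp: A_def B_def)
  have "b \<in> B" using step notC b cP by (auto simp: B_def)
  have "c \<in> A" "c \<notin> B" using cP by (simp_all add: A_def B_def)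
  have step': "y \<in> P \<and> f x \<noteq> f y" if "x \<in> P" "x \<noteq> c" "{x, y} \<in> edges G" for x y
    using step that by blast
  have BA: "card B < card A"
  proof (rule card_less_of_neighbours_in_H)
    show "y \<in> A" if "{x, y} \<in> edges G" "x \<in> B" "y \<in> H" for x y
      using step'[OF _ _ that(1)] that(2,3) by (auto simp: A_def B_def)
  qed (use \<open>b \<in> B\<close> fin in \<open>auto simp: A_def B_def\<close>)
  have card_A: "card A = Suc (card (A - {c}))" 
    using \<open>c \<in> A\<close> fin by (metis card_Suc_Diff1)
  have "0 < card B" using \<open>b \<in> B\<close> fin by (auto simp: card_gt_0_iff)
  with BA card_A have "0 < card (A - {c})" by linarith
  then have ne: "A - {c} \<noteq> {}" by (metis card.empty less_irrefl)
  have "card (A - {c}) < card B"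
  proof (rule card_less_of_neighbours_in_H)
    show "y \<in> B" if "{x, y} \<in> edges G" "x \<in> A - {c}" "y \<in> H" for x y
      using step'[OF _ _ that(1)] that(2,3) by (auto simp: A_def B_def)
  qed (use ne fin in \<open>auto simp: A_def B_def\<close>)
  with BA card_A show False by simp
qed

text \<open>No edge joins the cycle to the rest of \<open>H\<close>, so that rest is a closed bipartite part.\<close>

lemma H_eq_cycle: "H = verts C"
proof -
  obtain c where c: "c \<in> verts C" using cycle_nonempty by blast
  obtain d f where eC: "{c, d} \<in> edges C" and f: "proper_two_colouring (edges G - {{c, d}}) f"
    using two_colouring_minus_edge_at[OF c] .
  have "H - verts C = {}"
  proof (rule closed_bipartite_part_of_H_empty)
    fix a b assume ab: "{a, b} \<in> edges G" "a \<in> H - verts C" "b \<in> H"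
    have "b \<notin> verts C"
    proof
      assume "b \<in> verts C"
      then have "{b, a} \<in> edges C" using ab edge_commute by (intro edge_at_cycle_vertex_in_H) auto
      then show False using edge_of_cycle_subset[of a b] ab(2) by (simp add: insert_commute)
    qed
    moreover have "{a, b} \<noteq> {c, d}"
      using edge_of_cycle_subset[of a b] eC ab(2) by auto
    ultimately show "b \<in> H - verts C \<and> f a \<noteq> f b"
      using f ab by (auto simp: proper_two_colouring_def)
  qed simp
  then show ?thesis using cycle_subset_H by blast
qed

section \<open>The independence and matching numbers in the decomposition\<close>

abbreviation "k \<equiv> card (verts C) div 2"

lemma X_Y_C_partition:
  "verts G = X \<union> Y \<union> verts C" "X \<inter> verts C = {}" "Y \<inter> verts C = {}"
  using H_eq_cycle X_subset neighborhood_subset_verts by auto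

lemma card_verts: "card (verts G) = card X + card Y + (2 * k + 1)"
proof -
  have "card (verts G) = card (X \<union> Y) + card (verts C)"
    unfolding X_Y_C_partition(1) using X_Y_C_partition finite_X finite_neighborhood finite_cycle
    by (intro card_Un_disjoint) auto
  moreover have "card (X \<union> Y) = card X + card Y"
    using X_Y_disjoint finite_X finite_neighborhood by (intro card_Un_disjoint)
  ultimately show ?thesis using card_cycle(1) by linarith
qed

lemma independent_X_Un:
  assumes "I \<subseteq> verts C" "independent G I"
  shows "independent G (X \<union> I)" "card (X \<union> I) = card X + card I"
proof -
  have "{u, v} \<notin> edges G" if "u \<in> X" "v \<in> I" for u v
  proof
    assume "{u, v} \<in> edges G"
    then have "v \<in> Y" using that(1) edge_commute[of u v] by (auto simp: mem_neighborhood_iff)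
    then show False using that(2) assms(1) X_Y_C_partition(3) by blast
  qed
  then show "independent G (X \<union> I)"
    using X_independent assms(2) edge_commute unfolding independent_def by blast
  show "card (X \<union> I) = card X + card I"
    using assms(1) X_Y_C_partition(2) finite_X finite_subset[OF assms(1) finite_cycle]
    by (intro card_Un_disjoint) auto
qed

text \<open>The vertices of \<open>Y\<close> are matched by \<open>\<psi>\<close>, at most one of them to a cycle vertex \<open>c\<close>, and the rest of the
cycle is matched within itself. The matching has the same size whether or not \<open>c\<close> is used.\<close>

lemma matching_Y_Un_cycle:
  assumes c: "c \<in> verts C" and \<psi>: "inj_on \<psi> Y" "\<And>t. t \<in> Y \<Longrightarrow> \<psi> t \<in> X \<union> {c} \<and> {t, \<psi> t} \<in> edges G"
  obtains M where "matching G M" "\<Union>M \<subseteq> Y \<union> \<psi> ` Y \<union> (verts C - {c})" "card M = card Y + k"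
proof -
  define M1 where "M1 = (\<lambda>t. {t, \<psi> t}) ` Y"
  have "\<psi> ` Y \<inter> Y = {}" using \<psi>(2) X_Y_disjoint X_Y_C_partition(3) c by blast
  then have M1: "matching G M1" "card M1 = card Y"
    unfolding M1_def using matching_of_injection[OF \<psi>(1)] \<psi>(2) by auto
  obtain M2 where M2: "matching G M2" "\<Union>M2 \<subseteq> verts C - {c}" "2 * card M2 + 1 = card (verts C)"
    using matching_of_cycle_minus_vertex[OF c] .
  have sub1: "\<Union>M1 \<subseteq> Y \<union> \<psi> ` Y" by (auto simp: M1_def)
  have "(Y \<union> \<psi> ` Y) \<inter> (verts C - {c}) = {}" using \<psi>(2) X_Y_C_partition by blast
  then have disj: "disjnt d e" if "d \<in> M1" "e \<in> M2" for d e
    using sub1 M2(2) that unfolding disjnt_def by blast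
  have "matching G (M1 \<union> M2)"
    using M1(1) M2(1) disj unfolding matching_def pairwise_def by (auto simp: disjnt_sym)
  moreover have "{} \<notin> M1" by (auto simp: M1_def)
  then have "M1 \<inter> M2 = {}" using disj by (force simp: disjnt_def)
  moreover have "finite M1" "finite M2"
    using M1(1) M2(1) finite_edges[OF simple] finite_subset unfolding matching_def by blast+
  ultimately have "card (M1 \<union> M2) = card Y + k"
    using M1(2) M2(3) card_Un_disjoint[of M1 M2] by linarith
  moreover have "\<Union>(M1 \<union> M2) \<subseteq> Y \<union> \<psi> ` Y \<union> (verts C - {c})" using sub1 M2(2) by blast
  ultimately show thesis using that[OF \<open>matching G (M1 \<union> M2)\<close>] by blast
qed

lemma matching_missing_cycle_vertex:
  assumes c: "c \<in> verts C"
  obtains M where "matching G M" "c \<notin> \<Union>M" "card M = card Y + k"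
proof -
  obtain \<psi> where \<psi>: "inj_on \<psi> Y" "\<And>t. t \<in> Y \<Longrightarrow> \<psi> t \<in> X \<and> {t, \<psi> t} \<in> edges G"
    using matching_Y_into_X by blast
  obtain M where M: "matching G M" "\<Union>M \<subseteq> Y \<union> \<psi> ` Y \<union> (verts C - {c})" "card M = card Y + k"
    using matching_Y_Un_cycle[OF c \<psi>(1)] \<psi>(2) by blast
  have "c \<notin> Y \<union> \<psi> ` Y" using \<psi>(2) c X_Y_C_partition by blast
  with M show thesis using that by blast
qed

text \<open>The lower bounds come from explicit sets. Since the graph is not Konig-Egervary, the two numbers add
up to at most \<open>|X| + |Y| + 2 k\<close>, so that both lower bounds are attained.\<close>

lemma independence_number_eq: "independence_number G = card X + k"
  and matching_number_eq: "matching_number G = card Y + k"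
proof -
  obtain c where c: "c \<in> verts C" using cycle_nonempty by blast
  obtain I where I: "I \<subseteq> verts C - {c}" "independent G I" "2 * card I + 1 = card (verts C)"
    using independent_half_of_cycle[OF c] .
  obtain M where M: "matching G M" "card M = card Y + k"
    using matching_missing_cycle_vertex[OF c] by blast
  have IC: "I \<subseteq> verts C" using I(1) by blast
  have "card X + k \<le> independence_number G"
    using card_le_independence_number[OF simple independent_X_Un(1)[OF IC I(2)]]
      independent_X_Un(2)[OF IC I(2)] I(3) by linarith
  moreover have "card Y + k \<le> matching_number G"
    using card_le_matching_number[OF simple M(1)] M(2) by simp
  moreover have "independence_number G + matching_number G < card (verts G)"
    using independence_plus_matching_le[OF simple] not_konig_egervary
    by (simp add: konig_egervary_def)
  ultimately show "independence_number G = card X + k" "matching_number G = card Y + k"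
    using card_verts by linarith+
qed

section \<open>Which vertex deletions give a Konig-Egervary graph\<close>

lemma konig_egervary_del_cycle_vertex:
  assumes c: "c \<in> verts C"
  shows "konig_egervary (del_vertex G c)"
proof -
  obtain I where I: "I \<subseteq> verts C - {c}" "independent G I" "2 * card I + 1 = card (verts C)"
    using independent_half_of_cycle[OF c] .
  obtain M where M: "matching G M" "c \<notin> \<Union>M" "card M = card Y + k"
    using matching_missing_cycle_vertex[OF c] .
  have IC: "I \<subseteq> verts C" using I(1) by blast
  have "c \<notin> X \<union> I" using c I(1) X_Y_C_partition(2) by blast
  moreover have "card (verts G) \<le> Suc (card (X \<union> I) + card M)"
    using independent_X_Un(2)[OF IC I(2)] I(3) M(3) card_verts by linarith
  ultimately show ?thesis
    using konig_egervary_del_vertex_iff[OF simple, of c] c cycle_subset independent_X_Un(1)[OF IC I(2)] M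
    by blast
qed

text \<open>The independent set and the matching that witness the property for \<open>G - v\<close> have to be maximum in \<open>G\<close>,
and both miss \<open>v\<close>. A maximum matching covers \<open>Y\<close>: each edge of \<open>G\<close> meets \<open>Y\<close> or lies
within the cycle, which accounts for at most \<open>k\<close> matching edges.\<close>

lemma konig_egervary_del_vertex_imp:
  assumes "v \<in> verts G" "konig_egervary (del_vertex G v)"
  shows "v \<notin> core G" "v \<notin> Y"
proof -
  obtain S M where S: "independent G S" "v \<notin> S" and M: "matching G M" "v \<notin> \<Union>M"
    and card: "card (verts G) \<le> Suc (card S + card M)"
    using assms konig_egervary_del_vertex_iff[OF simple] by blast
  have le: "card S \<le> card X + k" "card M \<le> card Y + k"
    using card_le_independence_number[OF simple S(1)] card_le_matching_number[OF simple M(1)]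
    by (simp_all add: independence_number_eq matching_number_eq)
  have eq: "card S = card X + k" "card M = card Y + k"
    using le card card_verts by linarith+
  then have "maximum_independent G S" using S by (simp add: maximum_independent_def independence_number_eq)
  then show "v \<notin> core G" using S(2) by (auto simp: core_def)
  show "v \<notin> Y"
  proof
    assume v: "v \<in> Y"
    have "card M \<le> card (Y - {v}) + card (verts C) div 2"
    proof (rule card_matching_le[OF simple M(1)])
      fix e assume e: "e \<in> M"
      then have "e \<in> edges G" using M(1) by (auto simp: matching_def)
      then obtain a b where ab: "e = {a, b}" "a \<in> verts G" "b \<in> verts G" "{a, b} \<in> edges G"
        using edge_cases[OF simple] by metis
      have "v \<notin> e" using M(2) e by blast
      moreover have "a \<in> X \<Longrightarrow> b \<in> Y" "b \<in> X \<Longrightarrow> a \<in> Y"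
        using ab(4) edge_commute[of a b] by (auto simp: mem_neighborhood_iff)
      ultimately show "e \<inter> (Y - {v}) \<noteq> {} \<or> e \<subseteq> verts C"
        using ab X_Y_C_partition(1) by blast
    qed (use finite_neighborhood finite_cycle in auto)
    moreover have "card Y = Suc (card (Y - {v}))"
      using v finite_neighborhood by (metis card_Suc_Diff1)
    ultimately show False using eq(2) by linarith
  qed
qed

text \<open>\<open>X\<close> can be completed to a maximum independent set by half of the cycle, avoiding any given cycle
vertex.\<close>

lemma core_subset_X: "core G \<subseteq> X"
proof
  fix v assume v: "v \<in> core G"
  obtain c where c: "c \<in> verts C" "v \<in> verts C \<longrightarrow> c = v" using cycle_nonempty by blast
  obtain I where I: "I \<subseteq> verts C - {c}" "independent G I" "2 * card I + 1 = card (verts C)"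
    using independent_half_of_cycle[OF c(1)] .
  have IC: "I \<subseteq> verts C" using I(1) by blast
  have "card (X \<union> I) = independence_number G"
    using independent_X_Un(2)[OF IC I(2)] I(3) independence_number_eq by linarith
  then have "maximum_independent G (X \<union> I)"
    using independent_X_Un(1)[OF IC I(2)] by (simp add: maximum_independent_def)
  then have "v \<in> X \<union> I" using v by (auto simp: core_def)
  then show "v \<in> X" using I(1) c(2) by blast
qed

text \<open>The new set has the size of \<open>X\<close>, and its neighbours still lie in \<open>X \<union> Y\<close> because \<open>R\<close> has none on the
cycle. So it has at most \<open>|Y|\<close> neighbours and is as good as \<open>X\<close>.\<close>

lemma exchange_tight_set:
  assumes R: "R \<subseteq> Y" "independent G R" "card (neighborhood G R \<inter> X) \<le> card R"
    and far: "\<And>t c. t \<in> R \<Longrightarrow> c \<in> verts C \<Longrightarrow> {t, c} \<notin> edges G"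
  shows "maximum_critical_independent G ((X - neighborhood G R) \<union> R)"
proof -
  define X' where "X' = (X - neighborhood G R) \<union> R"
  have "{u, v} \<notin> edges G" if "u \<in> X - neighborhood G R" "v \<in> R" for u v
    using that by (auto simp: mem_neighborhood_iff)
  then have indep: "independent G X'"
    using X_independent R(2) edge_commute unfolding independent_def X'_def by blast
  have fin: "finite R" using R(1) finite_neighborhood finite_subset by blast
  have XY: "X' \<subseteq> X \<union> Y" using R(1) by (auto simp: X'_def)
  have "card X' = card (X - neighborhood G R) + card R"
    unfolding X'_def using R(1) X_Y_disjoint finite_X fin by (intro card_Un_disjoint) auto
  moreover have "card X = card (neighborhood G R \<inter> X) + card (X - neighborhood G R)"
    using card_Int_Diff[OF finite_X, of "neighborhood G R"] by (simp add: Int_commute)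
  ultimately have card_X': "card X' = card X" using R(3) hall_Y[OF R(1)] by linarith
  have "neighborhood G X' \<subseteq> (X \<union> Y) - X'"
  proof
    fix u assume "u \<in> neighborhood G X'"
    then obtain x where x: "x \<in> X'" "{u, x} \<in> edges G" by (auto simp: mem_neighborhood_iff)
    then have "u \<notin> X'" using indep by (auto simp: independent_def)
    moreover have "u \<in> X \<union> Y"
    proof (cases "x \<in> R")
      case True
      then have "u \<notin> verts C" using far[of x u] x(2) edge_commute by blast
      then show ?thesis using edge_endpoints(1)[OF simple x(2)] X_Y_C_partition(1) by blast
    next
      case False
      then show ?thesis using x by (auto simp: X'_def mem_neighborhood_iff)
    qed
    ultimately show "u \<in> (X \<union> Y) - X'" by simp
  qed
  then have "card (neighborhood G X') \<le> card ((X \<union> Y) - X')"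
    using finite_X finite_neighborhood by (intro card_mono) auto
  also have "\<dots> = card (X \<union> Y) - card X'"
    using XY finite_X finite_neighborhood by (intro card_Diff_subset finite_subset[OF XY]) auto
  also have "\<dots> = card Y"
    using card_X' X_Y_disjoint finite_X finite_neighborhood by (simp add: card_Un_disjoint)
  finally have "set_difference G X \<le> set_difference G X'"
    using card_X' by (simp add: set_difference_def)
  then have "critical_independent G X'"
    using indep critical[OF indep] maximum_critical
    by (simp add: set_difference_def maximum_critical_independent_def critical_independent_def)
  then show ?thesis
    using maximum_critical card_X' by (simp add: maximum_critical_independent_def flip: X'_def)
qed

text \<open>Hall's theorem for matching \<open>Y\<close> into \<open>X - {v}\<close>, where the cycle, represented by the value
\<^const>\<open>None\<close>, may serve as the partner of one vertex adjacent to it. The assumption \<open>reach\<close> says that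
the sets for which removing \<open>v\<close> hurts are compensated by this additional partner.\<close>

lemma maximum_matching_missing_X_vertex:
  assumes v: "v \<in> X"
    and reach: "\<And>R. R \<subseteq> Y \<Longrightarrow> v \<in> neighborhood G R \<Longrightarrow> card (neighborhood G R \<inter> X) \<le> card R \<Longrightarrow>
      \<exists>t\<in>R. \<exists>c\<in>verts C. {t, c} \<in> edges G"
  obtains M where "matching G M" "v \<notin> \<Union>M" "card M = card Y + k"
proof -
  define A where "A t = Some ` {x \<in> X - {v}. {t, x} \<in> edges G} \<union>
    (if \<exists>c\<in>verts C. {t, c} \<in> edges G then {None} else {})" for t
  have "\<exists>\<phi>. inj_on \<phi> Y \<and> (\<forall>t\<in>Y. \<phi> t \<in> A t)"
  proof (rule hall_distinct_representatives)
    fix R assume R: "R \<subseteq> Y"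
    let ?N = "neighborhood G R \<inter> X"
    have fin: "finite (\<Union>(A ` R))"
      using finite_subset[OF R finite_neighborhood] finite_X by (auto simp: A_def)
    have finN: "finite ?N" using finite_X by simp
    have sub: "Some ` (?N - {v}) \<subseteq> \<Union>(A ` R)"
    proof
      fix y assume "y \<in> Some ` (?N - {v})"
      then obtain x where x: "y = Some x" "x \<in> X - {v}" "x \<in> neighborhood G R" by blast
      then obtain t where t: "t \<in> R" "{x, t} \<in> edges G" by (auto simp: mem_neighborhood_iff)
      then have "{t, x} \<in> edges G" using edge_commute by blast
      with x t(1) show "y \<in> \<Union>(A ` R)" by (auto simp: A_def)
    qed
    have card_sub: "card (Some ` (?N - {v})) = card (?N - {v})"
      by (simp add: card_image)
    show "card R \<le> card (\<Union>(A ` R))"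
    proof (cases "v \<in> ?N \<and> card ?N \<le> card R")
      case True
      then obtain t c where "t \<in> R" "c \<in> verts C" "{t, c} \<in> edges G"
        using reach[OF R] by blast
      then have "None \<in> \<Union>(A ` R)" by (auto simp: A_def)
      then have "card (insert None (Some ` (?N - {v}))) \<le> card (\<Union>(A ` R))"
        using sub fin by (intro card_mono) auto
      moreover have "card (insert None (Some ` (?N - {v}))) = Suc (card (?N - {v}))"
        using finN card_sub by (subst card_insert_disjoint) auto
      moreover have "Suc (card (?N - {v})) = card ?N"
        using True finN by (metis card_Suc_Diff1)
      ultimately show ?thesis using hall_Y[OF R] by linarith
    next
      case False
      have "card R \<le> card (?N - {v})"
      proof (cases "v \<in> ?N")
        case True
        then have "Suc (card (?N - {v})) = card ?N" using finN by (metis card_Suc_Diff1)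
        then show ?thesis using True False by linarith
      next
        case False
        then have "?N - {v} = ?N" by blast
        then show ?thesis using hall_Y[OF R] by simp
      qed
      then show ?thesis using card_mono[OF fin sub] card_sub by linarith
    qed
  qed (use finite_X finite_neighborhood in \<open>auto simp: A_def\<close>)
  then obtain \<phi> where \<phi>: "inj_on \<phi> Y" "\<And>t. t \<in> Y \<Longrightarrow> \<phi> t \<in> A t" by blast
  obtain c where c: "c \<in> verts C" "\<And>t. t \<in> Y \<Longrightarrow> \<phi> t = None \<Longrightarrow> {t, c} \<in> edges G"
  proof (cases "\<exists>t\<in>Y. \<phi> t = None")
    case True
    then obtain t where t: "t \<in> Y" "\<phi> t = None" by blast
    then obtain c where "c \<in> verts C" "{t, c} \<in> edges G"
      using \<phi>(2)[of t] by (auto simp: A_def split: if_splits)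
    moreover have "s = t" if "s \<in> Y" "\<phi> s = None" for s
      using inj_onD[OF \<phi>(1), of s t] t that by simp
    ultimately show thesis using that by blast
  next
    case False
    obtain c where "c \<in> verts C" using cycle_nonempty by blast
    with False show thesis using that by blast
  qed
  define \<psi> where "\<psi> t = (case \<phi> t of None \<Rightarrow> c | Some x \<Rightarrow> x)" for t
  have val: "\<phi> t = None \<and> \<psi> t = c \<or> \<phi> t = Some (\<psi> t) \<and> \<psi> t \<in> X - {v} \<and> {t, \<psi> t} \<in> edges G"
    if "t \<in> Y" for t
    using \<phi>(2)[OF that] by (cases "\<phi> t") (auto simp: \<psi>_def A_def split: if_splits)
  have "c \<notin> X" using c(1) X_Y_C_partition(2) by blast
  have "inj_on \<psi> Y"
  proof (rule inj_onI)
    fix s t assume st: "s \<in> Y" "t \<in> Y" "\<psi> s = \<psi> t"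
    then have "\<phi> s = \<phi> t" using val[of s] val[of t] \<open>c \<notin> X\<close> by auto
    then show "s = t" using \<phi>(1) st by (auto dest: inj_onD)
  qed
  moreover have "\<psi> t \<in> X \<union> {c} \<and> {t, \<psi> t} \<in> edges G" if "t \<in> Y" for t
    using val[OF that] c(2)[OF that] by auto
  ultimately obtain M where M: "matching G M" "\<Union>M \<subseteq> Y \<union> \<psi> ` Y \<union> (verts C - {c})" "card M = card Y + k"
    using matching_Y_Un_cycle[OF c(1)] by blast
  have "v \<notin> \<psi> ` Y" using val v \<open>c \<notin> X\<close> by fastforce
  moreover have "v \<notin> Y" "v \<notin> verts C" using v X_Y_disjoint X_Y_C_partition(2) by blast+
  ultimately have "v \<notin> \<Union>M" using M(2) by blast
  with M show thesis using that by blast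
qed

text \<open>The cycle minus a vertex outside \<open>S\<close> has a perfect matching, and \<open>S\<close> takes at most one endpoint of
each of its edges.\<close>

lemma card_independent_Int_cycle_le:
  assumes S: "independent G S"
  shows "card (S \<inter> verts C) \<le> k"
proof -
  have le: "card (S \<inter> (verts C - {c})) \<le> k" if c: "c \<in> verts C" for c
  proof -
    obtain M where M: "matching G M" "\<Union>M \<subseteq> verts C - {c}" "2 * card M + 1 = card (verts C)"
      using matching_of_cycle_minus_vertex[OF c] .
    moreover have "card (verts C) = Suc (card (verts C - {c}))"
      using c finite_cycle by (metis card_Suc_Diff1)
    ultimately show ?thesis
      using card_independent_plus_matching_le[OF simple S M(1,2)] finite_cycle by fastforce
  qed
  obtain c where c: "c \<in> verts C" "c \<notin> S"
  proof (rule ccontr)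
    assume "\<not> thesis"
    then have "verts C \<subseteq> S" using that by blast
    obtain c where c: "c \<in> verts C" using cycle_nonempty by blast
    have "S \<inter> (verts C - {c}) = verts C - {c}" using \<open>verts C \<subseteq> S\<close> by blast
    then have "card (verts C - {c}) \<le> k" using le[OF c] by simp
    moreover have "card (verts C) = Suc (card (verts C - {c}))"
      using c finite_cycle by (metis card_Suc_Diff1)
    ultimately show False using card_cycle by linarith
  qed
  then have "S \<inter> verts C = S \<inter> (verts C - {c})" by blast
  then show ?thesis using le[OF c(1)] by simp
qed

text \<open>\<open>S\<close> has at most \<open>k\<close> vertices on the cycle, so it has at least \<open>|X|\<close> vertices in \<open>X \<union> Y\<close>. As \<open>T\<close> excludes
its at least \<open>|T|\<close> neighbours in \<open>X\<close>, this leaves no slack.\<close>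

lemma maximum_independent_trace:
  assumes S: "maximum_independent G S"
  defines "T \<equiv> S \<inter> Y"
  shows "card (neighborhood G T \<inter> X) = card T" "S \<inter> X = X - neighborhood G T"
proof -
  have indep: "independent G S" and card_S: "card S = card X + k"
    using S by (simp_all add: maximum_independent_def independence_number_eq)
  have fin: "finite S" using indep finite_subset_verts by (simp add: independent_def)
  have "S = (S \<inter> X) \<union> T \<union> (S \<inter> verts C)"
    using indep X_Y_C_partition(1) by (auto simp: independent_def T_def)
  then have "card S \<le> card (S \<inter> X) + card T + card (S \<inter> verts C)"
    by (metis card_Un_le add_le_mono1 le_trans)
  moreover have sub: "S \<inter> X \<subseteq> X - neighborhood G T"
    using indep by (auto simp: T_def mem_neighborhood_iff independent_def)
  moreover have "card (S \<inter> X) \<le> card (X - neighborhood G T)"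
    using sub finite_X by (intro card_mono) auto
  moreover have "card X = card (neighborhood G T \<inter> X) + card (X - neighborhood G T)"
    using card_Int_Diff[OF finite_X, of "neighborhood G T"] by (simp add: Int_commute)
  moreover have "card T \<le> card (neighborhood G T \<inter> X)" by (intro hall_Y) (simp add: T_def)
  ultimately have "card (neighborhood G T \<inter> X) = card T" "card (S \<inter> X) = card (X - neighborhood G T)"
    using card_S card_independent_Int_cycle_le[OF indep] by linarith+
  with sub show "card (neighborhood G T \<inter> X) = card T" "S \<inter> X = X - neighborhood G T"
    using finite_X card_subset_eq[of "X - neighborhood G T" "S \<inter> X"] by auto
qed

text \<open>A maximum independent set \<open>S\<close> missing \<open>v\<close> exists as \<open>v\<close> is not in the core. If every maximum matching
covered \<open>v\<close>, there would be a tight set \<open>R\<close> away from the cycle with \<open>v\<close> among its neighbours. The trace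
\<open>T\<close> of \<open>S\<close> on \<open>Y\<close> is another tight set with neighbour \<open>v\<close>. By submodularity \<open>R \<inter> T\<close> is tight and
\<open>N(R \<inter> T)\<close>, restricted to \<open>X\<close>, is the intersection of the two neighbourhoods, so it contains \<open>v\<close>. As
\<open>R \<inter> T\<close> is also independent, exchanging it expels \<open>v\<close> from a maximum critical independent set.\<close>

lemma konig_egervary_del_nucleus_minus_core_vertex:
  assumes nuc: "v \<in> nucleus G" and core: "v \<notin> core G"
  shows "konig_egervary (del_vertex G v)"
proof -
  have in_crit: "v \<in> Z" if "maximum_critical_independent G Z" for Z
    using nuc that unfolding nucleus_def by blast
  have v: "v \<in> X" using in_crit[OF maximum_critical] .
  obtain S where S: "maximum_independent G S" "v \<notin> S" using core by (auto simp: core_def)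
  have indep: "independent G S" and card_S: "card S = card X + k"
    using S by (simp_all add: maximum_independent_def independence_number_eq)
  define T where "T = S \<inter> Y"
  have T: "card (neighborhood G T \<inter> X) = card T" "S \<inter> X = X - neighborhood G T" "T \<subseteq> Y"
    using maximum_independent_trace[OF S(1)] by (auto simp: T_def)
  have "\<exists>t\<in>R. \<exists>c\<in>verts C. {t, c} \<in> edges G"
    if R: "R \<subseteq> Y" "v \<in> neighborhood G R" "card (neighborhood G R \<inter> X) \<le> card R" for R
  proof (rule ccontr)
    assume far: "\<not> ?thesis"
    let ?P = "neighborhood G R \<inter> X" and ?Q = "neighborhood G T \<inter> X"
    have fin: "finite R" "finite T" using R(1) T(3) finite_neighborhood finite_subset by blast+
    have "neighborhood G (R \<union> T) \<inter> X = ?P \<union> ?Q" by (auto simp: mem_neighborhood_iff)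
    then have "card (R \<union> T) \<le> card (?P \<union> ?Q)" using hall_Y[of "R \<union> T"] R(1) T(3) by simp
    moreover have sub: "neighborhood G (R \<inter> T) \<inter> X \<subseteq> ?P \<inter> ?Q" by (auto simp: mem_neighborhood_iff)
    have "card (neighborhood G (R \<inter> T) \<inter> X) \<le> card (?P \<inter> ?Q)"
      using sub finite_X by (intro card_mono) auto
    moreover have "card (R \<inter> T) \<le> card (neighborhood G (R \<inter> T) \<inter> X)"
      using R(1) by (intro hall_Y) auto
    moreover have "card ?P + card ?Q = card (?P \<union> ?Q) + card (?P \<inter> ?Q)"
      using finite_X by (intro card_Un_Int) auto
    moreover have "card R + card T = card (R \<union> T) + card (R \<inter> T)"
      using fin by (intro card_Un_Int)
    ultimately have eq: "card (neighborhood G (R \<inter> T) \<inter> X) = card (R \<inter> T)"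
      "card (neighborhood G (R \<inter> T) \<inter> X) = card (?P \<inter> ?Q)"
      using R(3) T(1) by linarith+
    have "neighborhood G (R \<inter> T) \<inter> X = ?P \<inter> ?Q"
      using sub eq(2) finite_X by (intro card_subset_eq) auto
    moreover have "v \<in> neighborhood G T" using v S(2) T(2) by blast
    ultimately have v_RT: "v \<in> neighborhood G (R \<inter> T)" using R(2) v by blast
    have "maximum_critical_independent G ((X - neighborhood G (R \<inter> T)) \<union> (R \<inter> T))"
    proof (rule exchange_tight_set)
      show "independent G (R \<inter> T)" using indep by (auto simp: T_def independent_def)
    qed (use R(1) eq far in auto)
    then have "v \<in> (X - neighborhood G (R \<inter> T)) \<union> (R \<inter> T)" by (rule in_crit)
    then show False using v_RT v R(1) X_Y_disjoint by blast
  qed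
  then obtain M where M: "matching G M" "v \<notin> \<Union>M" "card M = card Y + k"
    using maximum_matching_missing_X_vertex[OF v] by blast
  have "card (verts G) \<le> Suc (card S + card M)" using card_S M(3) card_verts by simp
  then show ?thesis
    using konig_egervary_del_vertex_iff[OF simple, of v] v X_subset indep S(2) M by blast
qed

end

theorem corollary3p8:
  fixes G C :: "'a ugraph"
  assumes "simple_graph G"
    and "almost_bipartite G"
    and "\<not> konig_egervary G"
    and "odd_cycle_of G C"
  shows "int (varrho_v G) = int (card (verts C)) + int (card (nucleus G)) - int (card (core G))"
proof -
  have unique: "D = C" if "odd_cycle_of G D" for D
    using assms(2,4) that unfolding almost_bipartite_def by blast
  interpret unique_odd_cycle G C
    by unfold_locales (fact assms(1) assms(4) unique)+
  have decomposition: "critical_decomposition G C X" if "maximum_critical_independent G X" for X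
    by unfold_locales (fact assms(3) that)+
  obtain X where X: "maximum_critical_independent G X"
    using maximum_critical_independent_exists[OF assms(1)] by blast
  interpret critical_decomposition G C X using decomposition[OF X] .
  have core_nucleus: "core G \<subseteq> nucleus G"
    using critical_decomposition.core_subset_X[OF decomposition] by (auto simp: nucleus_def)
  have nucleus_X: "nucleus G \<subseteq> X" using X by (auto simp: nucleus_def)
  have "{v \<in> verts G. konig_egervary (del_vertex G v)} = verts C \<union> (nucleus G - core G)"
  proof (intro set_eqI iffI)
    fix v assume v: "v \<in> {v \<in> verts G. konig_egervary (del_vertex G v)}"
    show "v \<in> verts C \<union> (nucleus G - core G)"
    proof (cases "v \<in> verts C")
      case False
      have "v \<in> Z" if "maximum_critical_independent G Z" for Z
      proof -
        interpret Z: critical_decomposition G C Z using decomposition[OF that] .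
        show ?thesis using v False Z.konig_egervary_del_vertex_imp(2) Z.X_Y_C_partition(1) by blast
      qed
      then show ?thesis using v konig_egervary_del_vertex_imp(1) by (auto simp: nucleus_def)
    qed simp
  next
    fix v assume "v \<in> verts C \<union> (nucleus G - core G)"
    then show "v \<in> {v \<in> verts G. konig_egervary (del_vertex G v)}"
      using konig_egervary_del_cycle_vertex konig_egervary_del_nucleus_minus_core_vertex
        cycle_subset(1) nucleus_X X_subset by blast
  qed
  then have "varrho_v G = card (verts C \<union> (nucleus G - core G))" by (simp add: varrho_v_def)
  also have "\<dots> = card (verts C) + card (nucleus G - core G)"
    using nucleus_X X_Y_C_partition(2) finite_cycle finite_subset[OF nucleus_X finite_X]
    by (intro card_Un_disjoint) auto
  finally have "varrho_v G = card (verts C) + card (nucleus G - core G)" .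
  moreover have "card (nucleus G) = card (core G) + card (nucleus G - core G)"
    using core_nucleus card_Int_Diff[OF finite_subset[OF nucleus_X finite_X], of "core G"]
    by (simp add: Int_absorb1)
  ultimately show ?thesis by simp
qed

end
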